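(* Let $d$ be a positive integer and let $G$ be a graph. If $G$ is minimally globally $d$-rigid, then for each subset $X\subseteq V(G)$ with $|X|\ge d+2$ we have $$|E(G[X])|\le r_d(G[X])+|X|-d-1\le (d+1)|X|-\binom{d+2}{2}.$$ The first inequality is strict unless $G[X]=K_{d+2}$.
   Context: Graphs are finite and simple. $G[X]$ is the subgraph of $G$ induced by $X$; $G-e$ is $G$ with the edge $e$ deleted; $K_{d+2}$ is the complete graph on $d+2$ vertices. Let $G=(V,E)$. A framework in $\mathbb{C}^d$ is a pair $(G,p)$ with $p:V\to\mathbb{C}^d$; it is generic if the $d|V|$ coordinates of $p$ do not satisfy any nonzero polynomial with rational coefficients. Put $m_{uv}(p)=\sum_{i=1}^d(p(u)_i-p(v)_i)^2$ and $m_{d,G}(p)=(m_{uv}(p))_{uv\in E}\in\mathbb{C}^E$. The generic rigidity matroid $\mathcal{R}_d(G)$ is the matroid on $E$ given by the rows of the Jacobian matrix of $m_{d,G}$ at any generic configuration $p$ (the result does not depend on $p$); $r_d(G)$ is its rank (zero if $E=\varnothing$). $G$ is globally $d$-rigid if for every generic framework $(G,p)$ in $\mathbb{C}^d$ and every framework $(G,q)$ in $\mathbb{C}^d$, $m_{d,G}(p)=m_{d,G}(q)$ implies $m_{uv}(p)=m_{uv}(q)$ for all $u,v\in V$. (This is known to be equivalent to the same condition with $\mathbb{R}^d$ in place of $\mathbb{C}^d$.) $G$ is minimally globally $d$-rigid if it is globally $d$-rigid but $G-e$ is not globally $d$-rigid for every $e\in E(G)$. *)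

theory Defs
  imports "HOL-Analysis.Analysis" "HOL-Library.Poly_Mapping"
begin

(* Edges are two-element sets of vertices. *)
record 'v graph =
  verts :: "'v set"
  edges :: "'v set set"

definition simple_graph :: "'v graph \<Rightarrow> bool" where
  "simple_graph G \<longleftrightarrow>
     finite (verts G) \<and> edges G \<subseteq> {e. e \<subseteq> verts G \<and> card e = 2}"

definition induced :: "'v graph \<Rightarrow> 'v set \<Rightarrow> 'v graph" where
  "induced G X = \<lparr>verts = X, edges = {e \<in> edges G. e \<subseteq> X}\<rparr>"

definition del_edge :: "'v graph \<Rightarrow> 'v set \<Rightarrow> 'v graph" where
  "del_edge G e = G\<lparr>edges := edges G - {e}\<rparr>"

definition is_complete_graph :: "nat \<Rightarrow> 'v graph \<Rightarrow> bool" where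
  "is_complete_graph n G \<longleftrightarrow>
     card (verts G) = n \<and> edges G = {e. e \<subseteq> verts G \<and> card e = 2}"

(* A point of d-space over the complex numbers is a function of which only the values at
   the coordinates i < d matter; likewise only the values of a configuration at vertices matter. *)
type_synonym 'v config = "'v \<Rightarrow> nat \<Rightarrow> complex"

(* Polynomials in variables indexed by 'x are finitely supported families of coefficients
   indexed by monomials, and monomials are finitely supported families of exponents. *)
definition eval_rat_poly :: "(('x \<Rightarrow>\<^sub>0 nat) \<Rightarrow>\<^sub>0 rat) \<Rightarrow> ('x \<Rightarrow> complex) \<Rightarrow> complex" where
  "eval_rat_poly P a =
     (\<Sum>m\<in>Poly_Mapping.keys P. of_rat (Poly_Mapping.lookup P m) *
        (\<Prod>x\<in>Poly_Mapping.keys m. a x ^ Poly_Mapping.lookup m x))"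

definition generic :: "nat \<Rightarrow> 'v set \<Rightarrow> 'v config \<Rightarrow> bool" where
  "generic d V p \<longleftrightarrow>
     (\<forall>P :: ('v \<times> nat \<Rightarrow>\<^sub>0 nat) \<Rightarrow>\<^sub>0 rat.
        P \<noteq> 0 \<and> (\<forall>m\<in>Poly_Mapping.keys P. Poly_Mapping.keys m \<subseteq> V \<times> {..<d}) \<longrightarrow>
        eval_rat_poly P (\<lambda>(v, i). p v i) \<noteq> 0)"

definition sq_len :: "nat \<Rightarrow> 'v config \<Rightarrow> 'v \<Rightarrow> 'v \<Rightarrow> complex" where
  "sq_len d p u v = (\<Sum>i<d. (p u i - p v i)\<^sup>2)"

(* The measurement map; well-defined on an edge because sq_len is symmetric,
   see measurement_edge. *)
definition measurement :: "nat \<Rightarrow> 'v config \<Rightarrow> 'v set \<Rightarrow> complex" where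
  "measurement d p e = (THE z. \<exists>u v. e = {u, v} \<and> z = sq_len d p u v)"

lemma sq_len_commute: "sq_len d p u v = sq_len d p v u"
  by (simp add: sq_len_def power2_commute)

lemma measurement_edge: "measurement d p {u, v} = sq_len d p u v"
  unfolding measurement_def
  by (rule the_equality) (auto simp: doubleton_eq_iff sq_len_commute)

(* Row e of the Jacobian matrix of the measurement map at p: its entry in column (w, i) is
   the partial derivative with respect to the i-th coordinate of w. *)
definition jacobian_row :: "nat \<Rightarrow> 'v config \<Rightarrow> 'v set \<Rightarrow> 'v \<times> nat \<Rightarrow> complex" where
  "jacobian_row d p e =
     (\<lambda>(w, i). deriv (\<lambda>t. measurement d (p(w := (p w)(i := t))) e) (p w i))"

(* The columns are indexed by V \<times> {..<d}. The rows are taken as a family indexed by F. *)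
definition rows_independent :: "nat \<Rightarrow> 'v set \<Rightarrow> 'v config \<Rightarrow> 'v set set \<Rightarrow> bool" where
  "rows_independent d V p F \<longleftrightarrow>
     (\<forall>c :: 'v set \<Rightarrow> complex.
        (\<forall>x \<in> V \<times> {..<d}. (\<Sum>e\<in>F. c e * jacobian_row d p e x) = 0) \<longrightarrow> (\<forall>e\<in>F. c e = 0))"

(* Independent sets of the generic rigidity matroid; the choice of generic p is immaterial. *)
definition rigidity_indep :: "nat \<Rightarrow> 'v graph \<Rightarrow> 'v set set \<Rightarrow> bool" where
  "rigidity_indep d G F \<longleftrightarrow>
     F \<subseteq> edges G \<and> rows_independent d (verts G) (SOME p. generic d (verts G) p) F"

definition rigidity_rank :: "nat \<Rightarrow> 'v graph \<Rightarrow> nat" where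
  "rigidity_rank d G = Max {card F | F. rigidity_indep d G F}"

definition globally_rigid :: "nat \<Rightarrow> 'v graph \<Rightarrow> bool" where
  "globally_rigid d G \<longleftrightarrow>
     (\<forall>p q. generic d (verts G) p \<and> (\<forall>e \<in> edges G. measurement d p e = measurement d q e) \<longrightarrow>
        (\<forall>u \<in> verts G. \<forall>v \<in> verts G. sq_len d p u v = sq_len d q u v))"

definition minimally_globally_rigid :: "nat \<Rightarrow> 'v graph \<Rightarrow> bool" where
  "minimally_globally_rigid d G \<longleftrightarrow>
     globally_rigid d G \<and> (\<forall>e \<in> edges G. \<not> globally_rigid d (del_edge G e))"

end

theory Submission
  imports Defs
begin

text \<open>
  Let \<open>E\<close> be the edge set of \<open>G[X]\<close>, let \<open>p\<close> be a generic configuration of \<open>X\<close>, and let \<open>B \<subseteq> E\<close>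
  be a basis of the rows of the Jacobian at \<open>p\<close>, so that \<open>r\<^sub>d(G[X]) = |B|\<close>. Each \<open>e \<in> E - B\<close> carries a
  fundamental stress: the linear dependence \<open>\<omega>\<^sup>e\<close> of the rows in \<open>B \<union> {e}\<close> with \<open>\<omega>\<^sup>e(e) = 1\<close>. Its stress
  matrix is a weighted Laplacian on \<open>X\<close>, and every row of this matrix is an affine dependence of the
  points of \<open>p\<close>. Since generic points are in general position, affine dependences form a space of
  dimension \<open>|X| - d - 1\<close>.

  The first inequality says that there are at most \<open>|X| - d - 1\<close> fundamental stresses. Suppose that
  the rows of the stress matrix of \<open>\<omega>\<^sup>e\<close> all lie in the span of the rows belonging to other
  fundamental stresses \<open>\<omega>\<^sup>j\<close>, \<open>j \<in> S\<close>. Let \<open>q\<close> have the same edge lengths as \<open>p\<close> on \<open>E - {e}\<close>. Each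
  \<open>\<omega>\<^sup>j\<close> avoids \<open>e\<close>, and a stress of a generic configuration is also a stress of every configuration
  with the same lengths on its support (\<open>universal_dependency\<close>). So the matrices of the \<open>\<omega>\<^sup>j\<close>, and
  hence that of \<open>\<omega>\<^sup>e\<close>, annihilate the coordinates of \<open>q\<close>: \<open>\<omega>\<^sup>e\<close> is a stress of \<open>q\<close>. Squared lengths are
  homogeneous of degree two, so by Euler's identity \<open>\<Sum> \<omega>\<^sup>e(a) m\<^sub>a\<close> vanishes both at \<open>p\<close> and at \<open>q\<close>; as
  all other terms agree, \<open>m\<^sub>e(p) = m\<^sub>e(q)\<close> (\<open>stress_redundant_imp_determined\<close>). Then \<open>G - e\<close> inherits
  global rigidity from \<open>G\<close>, against minimality. Therefore every fundamental stress has a row outside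
  the span of the rows of the others. These rows are linearly independent affine dependences, which
  gives the bound (\<open>nonbasis_bound\<close>).

  The second inequality is \<open>r\<^sub>d(G[X]) \<le> d |X| - (d + 1 choose 2)\<close>, the loss of rank due to the
  infinitesimal rigid motions (\<open>independent_rows_bound\<close>).

  If the first inequality is an equality, there is no room for a second independent row in the
  matrix of any \<open>\<omega>\<^sup>e\<close>, so every such matrix has rank one. Then the support of \<open>\<omega>\<^sup>e\<close> is a complete
  graph on at least \<open>d + 2\<close> vertices. If two supports shared an edge, a basis exchange would turn a
  combination of two different rank one matrices into a fundamental stress matrix, which again has
  rank one; this is impossible. So \<open>E\<close> contains \<open>|E - B|\<close> pairwise disjoint complete graphs of this
  size, and comparing with the rank bound leaves only one: \<open>G[X]\<close> is complete on \<open>d + 2\<close> vertices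
  (\<open>equality_imp_complete\<close>).

  The edge \<open>e\<close> is found at one generic configuration, but deleting it has to preserve global rigidity
  at all of them. Therefore stresses and spanning relations are produced as polynomials with
  rational coefficients (\<open>universal_stress\<close>, \<open>polynomial_solution\<close>), which are valid everywhere.
\<close>

section \<open>Linear systems\<close>

text \<open>This elimination statement replaces dimension theory in what follows: bounds on the size of an
  independent family come from having more unknowns than equations.\<close>

lemma homogeneous_system_nontrivial:
  fixes M :: "'r \<Rightarrow> 'c \<Rightarrow> 'a::field"
  assumes "finite R" "finite C" "card R < card C"
  shows "\<exists>x. (\<exists>c\<in>C. x c \<noteq> 0) \<and> (\<forall>r\<in>R. (\<Sum>c\<in>C. M r c * x c) = 0)"
  using assms
proof (induction R arbitrary: C M rule: finite_induct)
  case empty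
  then obtain c where "c \<in> C" by fastforce
  then show ?case by (intro exI[of _ "\<lambda>_. 1"]) auto
next
  case (insert r R)
  show ?case
  proof (cases "\<forall>c\<in>C. M r c = 0")
    case True
    have "card R < card C" using insert by simp
    from insert.IH[OF insert.prems(1) this, of M] True show ?thesis by auto
  next
    case False
    then obtain c0 where c0: "c0 \<in> C" "M r c0 \<noteq> 0" by blast
    \<comment> \<open>Equation r is solved for the unknown c0, and c0 is eliminated from the other equations.\<close>
    define C' where "C' = C - {c0}"
    have C: "C = insert c0 C'" "c0 \<notin> C'" "finite C'"
      using c0 insert.prems by (auto simp: C'_def)
    have "card R < card C'" using insert C by simp
    from insert.IH[OF C(3) this, of "\<lambda>r' c. M r' c - M r' c0 * M r c / M r c0"]
    obtain x where x: "\<exists>c\<in>C'. x c \<noteq> 0"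
      "\<And>r'. r' \<in> R \<Longrightarrow> (\<Sum>c\<in>C'. (M r' c - M r' c0 * M r c / M r c0) * x c) = 0"
      by blast
    define s where "s = (\<Sum>c\<in>C'. M r c * x c)"
    define x' where "x' = x(c0 := - s / M r c0)"
    have sum_x': "(\<Sum>c\<in>C. M r' c * x' c) = M r' c0 * (- s / M r c0) + (\<Sum>c\<in>C'. M r' c * x c)"
      for r'
      unfolding C(1) using C(2,3) by (auto simp: x'_def intro!: sum.cong)
    have "(\<Sum>c\<in>C. M r' c * x' c) = 0" if "r' \<in> R" for r'
    proof -
      have "0 = (\<Sum>c\<in>C'. M r' c * x c) - (\<Sum>c\<in>C'. M r' c0 / M r c0 * (M r c * x c))"
        using x(2)[OF that] by (simp add: sum_subtractf[symmetric] algebra_simps)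
      also have "(\<Sum>c\<in>C'. M r' c0 / M r c0 * (M r c * x c)) = M r' c0 / M r c0 * s"
        by (simp add: s_def sum_distrib_left)
      finally show ?thesis using sum_x'[of r'] by simp
    qed
    moreover have "(\<Sum>c\<in>C. M r c * x' c) = 0"
      using sum_x'[of r] c0 by (simp add: s_def)
    moreover have "\<exists>c\<in>C. x' c \<noteq> 0"
      using x(1) C by (auto simp: x'_def)
    ultimately show ?thesis by blast
  qed
qed

text \<open>A minimal set of columns on which the rows stay independent has at most as many elements as there
  are rows: otherwise the columns satisfy a linear relation, and a column that occurs in it can be
  dropped.\<close>

lemma independent_rows_on_few_columns:
  fixes M :: "'b \<Rightarrow> 'y \<Rightarrow> 'a::field"
  assumes "finite B" "finite Y"
    and indep: "\<And>c. (\<forall>y\<in>Y. (\<Sum>b\<in>B. c b * M b y) = 0) \<Longrightarrow> \<forall>b\<in>B. c b = 0"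
  shows "\<exists>K\<subseteq>Y. card K \<le> card B \<and>
           (\<forall>c. (\<forall>y\<in>K. (\<Sum>b\<in>B. c b * M b y) = 0) \<longrightarrow> (\<forall>b\<in>B. c b = 0))"
proof -
  define good where "good K \<longleftrightarrow> K \<subseteq> Y \<and>
    (\<forall>c. (\<forall>y\<in>K. (\<Sum>b\<in>B. c b * M b y) = 0) \<longrightarrow> (\<forall>b\<in>B. c b = 0))" for K
  have "good Y" using indep by (auto simp: good_def)
  then obtain K where K: "good K" and min: "\<And>K'. good K' \<Longrightarrow> card K \<le> card K'"
    using ex_has_least_nat[of good Y card] by blast
  have finK: "finite K" using K assms(2) finite_subset by (auto simp: good_def)
  have "card K \<le> card B"
  proof (rule ccontr)
    assume "\<not> card K \<le> card B"
    then obtain v where v: "\<exists>y\<in>K. v y \<noteq> 0" "\<forall>b\<in>B. (\<Sum>y\<in>K. M b y * v y) = 0"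
      using homogeneous_system_nontrivial[OF assms(1) finK, of M] by auto
    then obtain y0 where y0: "y0 \<in> K" "v y0 \<noteq> 0" by blast
    have "\<not> good (K - {y0})"
      using min[of "K - {y0}"] y0 finK by (metis card_Diff1_less not_le)
    then obtain c where c: "\<forall>y\<in>K - {y0}. (\<Sum>b\<in>B. c b * M b y) = 0" "\<not> (\<forall>b\<in>B. c b = 0)"
      using K by (auto simp: good_def)
    have "0 = (\<Sum>b\<in>B. c b * (\<Sum>y\<in>K. M b y * v y))" using v(2) by simp
    also have "\<dots> = (\<Sum>b\<in>B. \<Sum>y\<in>K. c b * M b y * v y)"
      by (simp add: sum_distrib_left mult.assoc)
    also have "\<dots> = (\<Sum>y\<in>K. \<Sum>b\<in>B. c b * M b y * v y)" by (rule sum.swap)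
    also have "\<dots> = (\<Sum>y\<in>K. (\<Sum>b\<in>B. c b * M b y) * v y)" by (simp add: sum_distrib_right)
    also have "\<dots> = (\<Sum>b\<in>B. c b * M b y0) * v y0"
      using c(1) by (subst sum.remove[OF finK y0(1)]) simp
    finally have "(\<Sum>b\<in>B. c b * M b y0) = 0" using y0 by simp
    then have "\<forall>y\<in>K. (\<Sum>b\<in>B. c b * M b y) = 0" using c(1) by blast
    then show False using K c(2) by (simp add: good_def)
  qed
  then show ?thesis using K by (intro exI[of _ K]) (simp add: good_def)
qed

section \<open>Polynomial functions with rational coefficients\<close>

text \<open>Polynomials are represented by the functions that they induce. The number is an upper bound for the
  total degree; it is kept because a relation of least degree is needed later, and because
  differentiation lowers it.\<close>

inductive rat_poly :: "'x set \<Rightarrow> nat \<Rightarrow> (('x \<Rightarrow> complex) \<Rightarrow> complex) \<Rightarrow> bool" for Y where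
  rat_poly_const: "rat_poly Y n (\<lambda>_. of_rat r)"
| rat_poly_var: "y \<in> Y \<Longrightarrow> rat_poly Y (Suc n) (\<lambda>x. x y)"
| rat_poly_add: "rat_poly Y n f \<Longrightarrow> rat_poly Y n g \<Longrightarrow> rat_poly Y n (\<lambda>x. f x + g x)"
| rat_poly_mult: "rat_poly Y n f \<Longrightarrow> rat_poly Y m g \<Longrightarrow> rat_poly Y (n + m) (\<lambda>x. f x * g x)"

definition rat_polys :: "'x set \<Rightarrow> (('x \<Rightarrow> complex) \<Rightarrow> complex) set" where
  "rat_polys Y = {f. \<exists>n. rat_poly Y n f}"

lemma rat_poly_mono_degree: "rat_poly Y n f \<Longrightarrow> n \<le> m \<Longrightarrow> rat_poly Y m f"
proof (induction arbitrary: m rule: rat_poly.induct)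
  case (rat_poly_var y n)
  then obtain m' where "m = Suc m'" by (metis Suc_le_D)
  then show ?case using rat_poly_var by (simp add: rat_poly.rat_poly_var)
next
  case (rat_poly_mult n f k g)
  then have "rat_poly Y (n + (m - n)) (\<lambda>x. f x * g x)"
    by (intro rat_poly.rat_poly_mult) auto
  then show ?case using rat_poly_mult.prems by simp
next
  case (rat_poly_const n r)
  show ?case by (rule rat_poly.rat_poly_const)
next
  case (rat_poly_add n f g)
  then show ?case by (intro rat_poly.rat_poly_add) auto
qed

lemma rat_poly_mono_vars: "rat_poly Y n f \<Longrightarrow> Y \<subseteq> Z \<Longrightarrow> rat_poly Z n f"
proof (induction rule: rat_poly.induct)
  case (rat_poly_const n r)
  show ?case by (rule rat_poly.rat_poly_const)
next
  case (rat_poly_var y n)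
  then show ?case by (intro rat_poly.rat_poly_var) auto
next
  case (rat_poly_add n f g)
  then show ?case by (intro rat_poly.rat_poly_add) auto
next
  case (rat_poly_mult n f m g)
  then show ?case by (intro rat_poly.rat_poly_mult) auto
qed

lemma rat_poly_cong: "rat_poly Y n f \<Longrightarrow> (\<And>y. y \<in> Y \<Longrightarrow> x y = x' y) \<Longrightarrow> f x = f x'"
  by (induction rule: rat_poly.induct) auto

lemma rat_poly_sum:
  "(\<And>i. i \<in> I \<Longrightarrow> rat_poly Y n (f i)) \<Longrightarrow> rat_poly Y n (\<lambda>x. \<Sum>i\<in>I. f i x)"
proof (induction I rule: infinite_finite_induct)
  case (insert i I)
  have "rat_poly Y n (\<lambda>x. f i x + (\<Sum>i\<in>I. f i x))"
    using insert.IH insert.prems by (intro rat_poly_add) auto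
  then show ?case using insert.hyps by simp
qed (use rat_poly_const[of Y n 0] in simp_all)

lemma rat_poly_power: "rat_poly Y n f \<Longrightarrow> rat_poly Y (n * k) (\<lambda>x. f x ^ k)"
proof (induction k)
  case 0
  show ?case using rat_poly_const[of Y 0 1] by simp
next
  case (Suc k)
  then show ?case using rat_poly_mult[of Y n f "n * k" "\<lambda>x. f x ^ k"] by simp
qed

lemma rat_poly_prod:
  assumes "\<And>i. i \<in> I \<Longrightarrow> rat_poly Y (n i) (f i)"
  shows "rat_poly Y (\<Sum>i\<in>I. n i) (\<lambda>x. \<Prod>i\<in>I. f i x)"
  using assms
proof (induction I rule: infinite_finite_induct)
  case (insert i I)
  have "rat_poly Y (n i + sum n I) (\<lambda>x. f i x * (\<Prod>i\<in>I. f i x))"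
    using insert.IH insert.prems by (intro rat_poly_mult) auto
  then show ?case using insert.hyps by simp
qed (use rat_poly_const[of Y 0 1] in simp_all)

lemma rat_polysI: "rat_poly Y n f \<Longrightarrow> f \<in> rat_polys Y"
  by (auto simp: rat_polys_def)

lemma rat_polys_const: "(\<lambda>_. of_rat r) \<in> rat_polys Y"
  by (rule rat_polysI) (rule rat_poly_const[where n = 0])

lemma rat_polys_zero: "(\<lambda>_. 0) \<in> rat_polys Y" and rat_polys_one: "(\<lambda>_. 1) \<in> rat_polys Y"
  using rat_polys_const[of 0] rat_polys_const[of 1] by auto

lemma rat_polys_var: "y \<in> Y \<Longrightarrow> (\<lambda>x. x y) \<in> rat_polys Y"
  by (rule rat_polysI) (rule rat_poly_var[where n = 0])

lemma rat_polys_add: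
  assumes "f \<in> rat_polys Y" "g \<in> rat_polys Y"
  shows "(\<lambda>x. f x + g x) \<in> rat_polys Y"
proof -
  obtain n m where "rat_poly Y n f" "rat_poly Y m g" using assms by (auto simp: rat_polys_def)
  then have "rat_poly Y (max n m) f" "rat_poly Y (max n m) g"
    by (auto intro: rat_poly_mono_degree)
  then show ?thesis by (intro rat_polysI[OF rat_poly_add])
qed

lemma rat_polys_mult:
  assumes "f \<in> rat_polys Y" "g \<in> rat_polys Y"
  shows "(\<lambda>x. f x * g x) \<in> rat_polys Y"
proof -
  obtain n m where "rat_poly Y n f" "rat_poly Y m g" using assms by (auto simp: rat_polys_def)
  then show ?thesis by (intro rat_polysI[OF rat_poly_mult])
qed

lemma rat_polys_minus: "f \<in> rat_polys Y \<Longrightarrow> (\<lambda>x. - f x) \<in> rat_polys Y"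
  using rat_polys_mult[OF rat_polys_const[of "-1"], of f Y] by (simp add: of_rat_minus)

lemma rat_polys_diff:
  "f \<in> rat_polys Y \<Longrightarrow> g \<in> rat_polys Y \<Longrightarrow> (\<lambda>x. f x - g x) \<in> rat_polys Y"
  using rat_polys_add[OF _ rat_polys_minus, of f Y g] by simp

lemma rat_polys_sum:
  "(\<And>i. i \<in> I \<Longrightarrow> f i \<in> rat_polys Y) \<Longrightarrow> (\<lambda>x. \<Sum>i\<in>I. f i x) \<in> rat_polys Y"
proof (induction I rule: infinite_finite_induct)
  case (insert i I)
  have "(\<lambda>x. f i x + (\<Sum>i\<in>I. f i x)) \<in> rat_polys Y"
    using insert.IH insert.prems by (intro rat_polys_add) auto
  then show ?case using insert.hyps by simp
qed (simp_all add: rat_polys_zero)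

lemma rat_polys_mono: "f \<in> rat_polys Y \<Longrightarrow> Y \<subseteq> Z \<Longrightarrow> f \<in> rat_polys Z"
  by (auto simp: rat_polys_def intro: rat_poly_mono_vars)

lemma rat_polys_cong: "f \<in> rat_polys Y \<Longrightarrow> (\<And>y. y \<in> Y \<Longrightarrow> x y = x' y) \<Longrightarrow> f x = f x'"
  by (auto simp: rat_polys_def intro: rat_poly_cong)

lemma rat_polys_compose:
  assumes "rat_poly A n P" "\<And>a. a \<in> A \<Longrightarrow> g a \<in> rat_polys Y"
  shows "(\<lambda>x. P (\<lambda>a. g a x)) \<in> rat_polys Y"
  using assms
proof (induction rule: rat_poly.induct)
  case (rat_poly_const n r)
  show ?case by (rule rat_polys_const)
next
  case (rat_poly_add n f g)
  then show ?case by (intro rat_polys_add) auto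
next
  case (rat_poly_mult n f m g)
  then show ?case by (intro rat_polys_mult) auto
qed auto

text \<open>One family \<open>D\<close> of partial derivatives is good for all curves at once, so that the same \<open>D\<close> can be
  evaluated along coordinate lines and along segments. Partial derivatives of a polynomial of degree
  bound 0 are zero, which has to be stated separately because \<open>n - 1\<close> truncates.\<close>

lemma rat_poly_chain_rule:
  assumes "rat_poly A n P" "finite A"
  shows "\<exists>D. (\<forall>a. if n = 0 then D a = (\<lambda>_. 0) else rat_poly A (n - 1) (D a)) \<and>
    (\<forall>\<gamma> \<gamma>' t. (\<forall>a\<in>A. (\<gamma> a has_field_derivative \<gamma>' a) (at t)) \<longrightarrow>
       ((\<lambda>t. P (\<lambda>a. \<gamma> a t)) has_field_derivative (\<Sum>a\<in>A. D a (\<lambda>a. \<gamma> a t) * \<gamma>' a)) (at t))"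
  using assms
proof (induction rule: rat_poly.induct)
  case (rat_poly_const n r)
  show ?case
    using rat_poly.rat_poly_const[of A "n - 1" 0] by (intro exI[of _ "\<lambda>_ _. 0"]) auto
next
  case (rat_poly_var b n)
  let ?D = "\<lambda>a (_ :: 'a \<Rightarrow> complex). of_rat (if a = b then 1 else 0) :: complex"
  have "(\<Sum>a\<in>A. ?D a z * h a) = h b" for z h
    using rat_poly_var by (simp add: if_distrib[of of_rat] if_distrib[of "\<lambda>z. z * _"] cong: if_cong)
  moreover have "rat_poly A n (?D a)" for a by (rule rat_poly.rat_poly_const)
  ultimately show ?case using rat_poly_var by (intro exI[of _ ?D]) simp
next
  case (rat_poly_add n f g)
  then obtain D D' where
    D: "\<forall>a. if n = 0 then D a = (\<lambda>_. 0) else rat_poly A (n - 1) (D a)"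
      "\<And>\<gamma> \<gamma>' t. (\<forall>a\<in>A. (\<gamma> a has_field_derivative \<gamma>' a) (at t)) \<Longrightarrow>
       ((\<lambda>t. f (\<lambda>a. \<gamma> a t)) has_field_derivative (\<Sum>a\<in>A. D a (\<lambda>a. \<gamma> a t) * \<gamma>' a)) (at t)"
    and D': "\<forall>a. if n = 0 then D' a = (\<lambda>_. 0) else rat_poly A (n - 1) (D' a)"
      "\<And>\<gamma> \<gamma>' t. (\<forall>a\<in>A. (\<gamma> a has_field_derivative \<gamma>' a) (at t)) \<Longrightarrow>
       ((\<lambda>t. g (\<lambda>a. \<gamma> a t)) has_field_derivative (\<Sum>a\<in>A. D' a (\<lambda>a. \<gamma> a t) * \<gamma>' a)) (at t)"
    by blast
  show ?case
  proof (rule exI[of _ "\<lambda>a x. D a x + D' a x"], intro conjI allI impI)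
    fix a
    show "if n = 0 then (\<lambda>x. D a x + D' a x) = (\<lambda>_. 0)
          else rat_poly A (n - 1) (\<lambda>x. D a x + D' a x)"
      using D(1) D'(1) by (auto intro: rat_poly.rat_poly_add)
  next
    fix \<gamma> :: "'a \<Rightarrow> complex \<Rightarrow> complex" and \<gamma>' t
    assume "\<forall>a\<in>A. (\<gamma> a has_field_derivative \<gamma>' a) (at t)"
    from DERIV_add[OF D(2)[OF this] D'(2)[OF this]]
    show "((\<lambda>t. f (\<lambda>a. \<gamma> a t) + g (\<lambda>a. \<gamma> a t)) has_field_derivative
      (\<Sum>a\<in>A. (D a (\<lambda>a. \<gamma> a t) + D' a (\<lambda>a. \<gamma> a t)) * \<gamma>' a)) (at t)"
      by (simp add: sum.distrib distrib_right)
  qed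
next
  case (rat_poly_mult n f m g)
  then obtain D D' where
    D: "\<forall>a. if n = 0 then D a = (\<lambda>_. 0) else rat_poly A (n - 1) (D a)"
      "\<And>\<gamma> \<gamma>' t. (\<forall>a\<in>A. (\<gamma> a has_field_derivative \<gamma>' a) (at t)) \<Longrightarrow>
       ((\<lambda>t. f (\<lambda>a. \<gamma> a t)) has_field_derivative (\<Sum>a\<in>A. D a (\<lambda>a. \<gamma> a t) * \<gamma>' a)) (at t)"
    and D': "\<forall>a. if m = 0 then D' a = (\<lambda>_. 0) else rat_poly A (m - 1) (D' a)"
      "\<And>\<gamma> \<gamma>' t. (\<forall>a\<in>A. (\<gamma> a has_field_derivative \<gamma>' a) (at t)) \<Longrightarrow>
       ((\<lambda>t. g (\<lambda>a. \<gamma> a t)) has_field_derivative (\<Sum>a\<in>A. D' a (\<lambda>a. \<gamma> a t) * \<gamma>' a)) (at t)"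
    by blast
  have zero: "rat_poly A k (\<lambda>_. 0)" for k using rat_poly.rat_poly_const[of A k 0] by simp
  show ?case
  proof (rule exI[of _ "\<lambda>a x. D a x * g x + f x * D' a x"], intro conjI allI impI)
    fix a
    have 1: "rat_poly A (n + m - 1) (\<lambda>x. D a x * g x)"
    proof (cases "n = 0")
      case False
      then have "rat_poly A (n - 1 + m) (\<lambda>x. D a x * g x)"
        using D(1) rat_poly_mult.hyps by (intro rat_poly.rat_poly_mult) auto
      then show ?thesis using False by simp
    qed (use D(1) zero in simp)
    have 2: "rat_poly A (n + m - 1) (\<lambda>x. f x * D' a x)"
    proof (cases "m = 0")
      case False
      then have "rat_poly A (n + (m - 1)) (\<lambda>x. f x * D' a x)"
        using D'(1) rat_poly_mult.hyps by (intro rat_poly.rat_poly_mult) auto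
      then show ?thesis using False by simp
    qed (use D'(1) zero in simp)
    show "if n + m = 0 then (\<lambda>x. D a x * g x + f x * D' a x) = (\<lambda>_. 0)
          else rat_poly A (n + m - 1) (\<lambda>x. D a x * g x + f x * D' a x)"
      using D(1) D'(1) rat_poly.rat_poly_add[OF 1 2] by auto
  next
    fix \<gamma> :: "'a \<Rightarrow> complex \<Rightarrow> complex" and \<gamma>' t
    assume "\<forall>a\<in>A. (\<gamma> a has_field_derivative \<gamma>' a) (at t)"
    from DERIV_mult[OF D(2)[OF this] D'(2)[OF this]]
    show "((\<lambda>t. f (\<lambda>a. \<gamma> a t) * g (\<lambda>a. \<gamma> a t)) has_field_derivative
      (\<Sum>a\<in>A. (D a (\<lambda>a. \<gamma> a t) * g (\<lambda>a. \<gamma> a t) + f (\<lambda>a. \<gamma> a t) * D' a (\<lambda>a. \<gamma> a t)) * \<gamma>' a)) (at t)"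
      by (simp add: sum.distrib distrib_right sum_distrib_left sum_distrib_right algebra_simps)
  qed
qed

section \<open>Monomials and algebraic dependence\<close>

definition monomial :: "'x set \<Rightarrow> ('x \<Rightarrow> nat) \<Rightarrow> ('x \<Rightarrow> complex) \<Rightarrow> complex" where
  "monomial Y m x = (\<Prod>y\<in>Y. x y ^ m y)"

text \<open>Exponents are bounded in each variable separately, so that they are easy to count.\<close>

definition exponents :: "'x set \<Rightarrow> nat \<Rightarrow> ('x \<Rightarrow> nat) set" where
  "exponents Y D = Y \<rightarrow>\<^sub>E {..D}"

lemma finite_exponents: "finite Y \<Longrightarrow> finite (exponents Y D)"
  by (simp add: exponents_def finite_PiE)

lemma card_exponents: "finite Y \<Longrightarrow> card (exponents Y D) = (D + 1) ^ card Y"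
  by (simp add: exponents_def card_PiE)

lemma monomial_restrict: "monomial Y (restrict m Y) = monomial Y m"
  by (auto simp: monomial_def fun_eq_iff intro!: prod.cong)

lemma collect_monomials:
  assumes "finite Y" "finite S" "\<And>i. i \<in> S \<Longrightarrow> h i \<in> exponents Y D"
  shows "\<exists>c. \<forall>x. (\<Sum>i\<in>S. of_rat (r i) * monomial Y (h i) x) =
                 (\<Sum>m\<in>exponents Y D. of_rat (c m) * monomial Y m x)"
proof (intro exI allI)
  fix x
  let ?c = "\<lambda>m. \<Sum>i\<in>{i\<in>S. h i = m}. r i"
  have "(\<Sum>i\<in>S. of_rat (r i) * monomial Y (h i) x) =
    (\<Sum>m\<in>exponents Y D. \<Sum>i\<in>{i\<in>S. h i = m}. of_rat (r i) * monomial Y (h i) x)"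
    using assms by (intro sum.group[symmetric]) (auto simp: finite_exponents)
  also have "\<dots> = (\<Sum>m\<in>exponents Y D. of_rat (?c m) * monomial Y m x)"
    by (intro sum.cong refl) (auto simp: of_rat_sum sum_distrib_right)
  finally show "(\<Sum>i\<in>S. of_rat (r i) * monomial Y (h i) x) =
    (\<Sum>m\<in>exponents Y D. of_rat (?c m) * monomial Y m x)" .
qed

lemma rat_poly_as_monomials:
  assumes "rat_poly Y n f" "finite Y"
  shows "\<exists>c. \<forall>x. f x = (\<Sum>m\<in>exponents Y n. of_rat (c m) * monomial Y m x)"
  using assms
proof (induction rule: rat_poly.induct)
  case (rat_poly_const n r)
  have "monomial Y (restrict (\<lambda>_. 0) Y) x = 1" for x
    by (simp add: monomial_restrict) (simp add: monomial_def)
  then show ?case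
    using collect_monomials[OF assms(2), of "{()}" "\<lambda>_. restrict (\<lambda>_. 0) Y" n "\<lambda>_. r"]
    by (auto simp: exponents_def)
next
  case (rat_poly_var y n)
  let ?m = "\<lambda>z. if z = y then 1 else 0 :: nat"
  have "monomial Y (restrict ?m Y) x = x y" for x
  proof -
    have "monomial Y ?m x = (\<Prod>z\<in>Y. if z = y then x z else 1)"
      by (auto simp: monomial_def intro!: prod.cong)
    then show ?thesis using rat_poly_var by (simp add: monomial_restrict)
  qed
  then show ?case
    using collect_monomials[OF assms(2), of "{()}" "\<lambda>_. restrict ?m Y" "Suc n" "\<lambda>_. 1"]
    by (auto simp: exponents_def)
next
  case (rat_poly_add n f g)
  then obtain c c' where "\<forall>x. f x = (\<Sum>m\<in>exponents Y n. of_rat (c m) * monomial Y m x)"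
    "\<forall>x. g x = (\<Sum>m\<in>exponents Y n. of_rat (c' m) * monomial Y m x)" by blast
  then show ?case
    by (intro exI[of _ "\<lambda>m. c m + c' m"]) (simp add: of_rat_add distrib_right sum.distrib)
next
  case (rat_poly_mult n f k g)
  then obtain c c' where c: "\<And>x. f x = (\<Sum>m\<in>exponents Y n. of_rat (c m) * monomial Y m x)"
    "\<And>x. g x = (\<Sum>m\<in>exponents Y k. of_rat (c' m) * monomial Y m x)" by blast
  let ?S = "exponents Y n \<times> exponents Y k"
  let ?h = "\<lambda>(m, m'). restrict (\<lambda>y. m y + m' y) Y"
  let ?r = "\<lambda>(m, m'). c m * c' m'"
  have "f x * g x = (\<Sum>i\<in>?S. of_rat (?r i) * monomial Y (?h i) x)" for x
    unfolding c sum_product sum.cartesian_product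
    by (intro sum.cong refl)
       (auto simp: monomial_restrict, simp add: monomial_def of_rat_mult power_add prod.distrib)
  moreover have "?h i \<in> exponents Y (n + k)" if "i \<in> ?S" for i
    using that by (auto simp: exponents_def PiE_iff intro!: add_mono)
  ultimately show ?case
    using collect_monomials[OF assms(2), of ?S ?h "n + k" ?r] finite_exponents[OF assms(2)]
    by auto
qed

text \<open>Induction on the variables: for fixed values of the others, the sum is a polynomial in the new
  variable that vanishes everywhere, so each of its coefficients vanishes.\<close>

lemma monomials_independent:
  assumes "finite A" "\<And>x. (\<Sum>m\<in>exponents A D. c m * monomial A m x) = 0"
    and "m \<in> exponents A D"
  shows "c m = 0"
  using assms
proof (induction A arbitrary: c m rule: finite_induct)
  case empty
  from empty.prems show ?case by (simp add: exponents_def monomial_def)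
next
  case (insert a A)
  let ?up = "\<lambda>(j, m). m(a := j)"
  have split: "exponents (insert a A) D = ?up ` ({..D} \<times> exponents A D)"
    by (simp add: exponents_def PiE_insert_eq)
  have inj: "inj_on ?up ({..D} \<times> exponents A D)"
  proof (rule inj_onI, clarify)
    fix j m j' m'
    assume m: "m \<in> exponents A D" "m' \<in> exponents A D" and eq: "m(a := j) = m'(a := j')"
    have "m y = m' y" for y
    proof (cases "y = a")
      case True
      then show ?thesis using m insert.hyps by (simp add: exponents_def PiE_iff extensional_def)
    next
      case False
      then show ?thesis using fun_cong[OF eq, of y] by simp
    qed
    then show "j = j' \<and> m = m'" using fun_cong[OF eq, of a] by auto
  qed
  have mono: "monomial (insert a A) (m(a := j)) x = x a ^ j * monomial A m x" for m j x
  proof -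
    have "(\<Prod>y\<in>A. x y ^ (m(a := j)) y) = (\<Prod>y\<in>A. x y ^ m y)"
      using insert.hyps by (intro prod.cong) auto
    then show ?thesis using insert.hyps by (simp add: monomial_def)
  qed
  have "(\<Sum>m\<in>exponents A D. c (m(a := j)) * monomial A m x) = 0" if "j \<le> D" for j x
  proof -
    let ?b = "\<lambda>j. \<Sum>m\<in>exponents A D. c (m(a := j)) * monomial A m x"
    have "(\<Sum>j\<le>D. ?b j * t ^ j) = 0" for t
    proof -
      let ?x = "x(a := t)"
      have same: "monomial A m ?x = monomial A m x" for m
        using insert.hyps by (auto simp: monomial_def intro!: prod.cong)
      have "0 = (\<Sum>(j, m)\<in>{..D} \<times> exponents A D.
          c (m(a := j)) * monomial (insert a A) (m(a := j)) ?x)"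
        using insert.prems(1)[of ?x] unfolding split sum.reindex[OF inj]
        by (simp add: case_prod_unfold)
      also have "\<dots> = (\<Sum>j\<le>D. ?b j * t ^ j)"
        by (subst sum.cartesian_product[symmetric])
           (auto simp: mono same sum_distrib_right sum_distrib_left mult_ac intro!: sum.cong)
      finally show ?thesis by simp
    qed
    then show ?thesis using that polyfun_eq_0[of ?b D] by blast
  qed
  then have "c (m(a := j)) = 0" if "j \<le> D" "m \<in> exponents A D" for j m
    using insert.IH[of "\<lambda>m. c (m(a := j))" m] that by blast
  with insert.prems(2) show ?case unfolding split by auto
qed

text \<open>More polynomials than variables satisfy a polynomial relation, by counting. The monomials in the
  given polynomials with exponents up to \<open>D\<close> number \<open>(D + 1) ^ card A\<close>. They lie in a space of
  polynomials with exponents up to a constant multiple of \<open>D\<close>, whose dimension is of order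
  \<open>D ^ card Y\<close> only. So for large \<open>D\<close> they are linearly dependent over the rationals.\<close>

lemma algebraically_dependent:
  fixes g :: "'a \<Rightarrow> ('x \<Rightarrow> complex) \<Rightarrow> complex"
  assumes "finite Y" "finite A" "card Y < card A" "\<And>a. a \<in> A \<Longrightarrow> rat_poly Y k (g a)"
  shows "\<exists>n P. rat_poly A n P \<and> (\<exists>x. P x \<noteq> 0) \<and> (\<forall>x. P (\<lambda>a. g a x) = 0)"
proof -
  define N where "N = card Y"
  define L where "L = k * card A + 1"
  \<comment> \<open>This choice makes (K + 1)^N smaller than (D + 1)^(N + 1).\<close>
  define D where "D = L ^ N"
  define K where "K = k * D * card A"
  have mono: "rat_poly Y K (\<lambda>x. monomial A m (\<lambda>a. g a x))" if "m \<in> exponents A D" for m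
  proof -
    have "rat_poly Y (\<Sum>a\<in>A. k * m a) (\<lambda>x. monomial A m (\<lambda>a. g a x))"
      unfolding monomial_def using assms(4) by (intro rat_poly_prod rat_poly_power)
    moreover have "(\<Sum>a\<in>A. k * m a) \<le> (\<Sum>a\<in>A. k * D)"
      using that by (intro sum_mono) (auto simp: exponents_def PiE_iff)
    ultimately show ?thesis
      by (elim rat_poly_mono_degree) (simp add: K_def mult.commute)
  qed
  have "\<forall>m\<in>exponents A D. \<exists>c. \<forall>x.
      monomial A m (\<lambda>a. g a x) = (\<Sum>l\<in>exponents Y K. of_rat (c l) * monomial Y l x)"
    using rat_poly_as_monomials[OF mono assms(1)] by blast
  then obtain c where c: "\<And>m x. m \<in> exponents A D \<Longrightarrow>
      monomial A m (\<lambda>a. g a x) = (\<Sum>l\<in>exponents Y K. of_rat (c m l) * monomial Y l x)"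
    using bchoice[of "exponents A D"] by metis
  have "card (exponents Y K) < card (exponents A D)"
  proof -
    have L: "L \<ge> 1" by (simp add: L_def)
    have "K + 1 \<le> L * (D + 1)" by (simp add: K_def L_def algebra_simps)
    then have "(K + 1) ^ N \<le> L ^ N * (D + 1) ^ N"
      by (metis power_mono power_mult_distrib zero_le)
    also have "\<dots> < (D + 1) * (D + 1) ^ N" by (simp add: D_def)
    also have "\<dots> = (D + 1) ^ Suc N" by simp
    also have "\<dots> \<le> (D + 1) ^ card A" using assms(3) by (intro power_increasing) (auto simp: N_def)
    finally show ?thesis using assms by (simp add: card_exponents N_def)
  qed
  from homogeneous_system_nontrivial[OF finite_exponents[OF assms(1)] finite_exponents[OF assms(2)] this,
      of "\<lambda>l m. c m l"]
  obtain x where x: "\<exists>m\<in>exponents A D. x m \<noteq> 0"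
    "\<And>l. l \<in> exponents Y K \<Longrightarrow> (\<Sum>m\<in>exponents A D. c m l * x m) = 0" by blast
  define P where "P = (\<lambda>z. \<Sum>m\<in>exponents A D. of_rat (x m) * monomial A m z)"
  have "rat_poly A (card A * D) (\<lambda>z. of_rat (x m) * monomial A m z)" if "m \<in> exponents A D" for m
  proof -
    have "rat_poly A (\<Sum>a\<in>A. Suc 0 * m a) (monomial A m)"
      unfolding monomial_def by (intro rat_poly_prod rat_poly_power rat_poly_var)
    moreover have "(\<Sum>a\<in>A. Suc 0 * m a) \<le> (\<Sum>a\<in>A. D)"
      using that by (intro sum_mono) (auto simp: exponents_def PiE_iff)
    ultimately have "rat_poly A (card A * D) (monomial A m)"
      by (elim rat_poly_mono_degree) simp
    from rat_poly_mult[OF rat_poly_const[of A 0 "x m"] this] show ?thesis by simp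
  qed
  then have "rat_poly A (card A * D) P"
    unfolding P_def by (rule rat_poly_sum)
  moreover have "P (\<lambda>a. g a z) = 0" for z
  proof -
    have "P (\<lambda>a. g a z) = (\<Sum>m\<in>exponents A D. \<Sum>l\<in>exponents Y K.
        of_rat (c m l * x m) * monomial Y l z)"
      unfolding P_def by (auto simp: c of_rat_mult sum_distrib_left mult_ac intro!: sum.cong)
    also have "\<dots> = (\<Sum>l\<in>exponents Y K. of_rat (\<Sum>m\<in>exponents A D. c m l * x m) * monomial Y l z)"
      by (subst sum.swap) (simp add: of_rat_sum sum_distrib_right)
    finally show ?thesis using x(2) by simp
  qed
  moreover have "\<exists>z. P z \<noteq> 0"
  proof (rule ccontr)
    assume "\<not> (\<exists>z. P z \<noteq> 0)"
    then have "complex_of_rat (x m) = 0" if "m \<in> exponents A D" for m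
      using monomials_independent[OF assms(2) _ that, of "\<lambda>m. of_rat (x m)"] by (simp add: P_def)
    then show False using x(1) by auto
  qed
  ultimately show ?thesis by blast
qed

section \<open>Generic points\<close>

definition generic_point :: "'x set \<Rightarrow> ('x \<Rightarrow> complex) \<Rightarrow> bool" where
  "generic_point Y p \<longleftrightarrow> (\<forall>f\<in>rat_polys Y. f p = 0 \<longrightarrow> (\<forall>x. f x = 0))"

lemma generic_pointD: "generic_point Y p \<Longrightarrow> f \<in> rat_polys Y \<Longrightarrow> f p = 0 \<Longrightarrow> f x = 0"
  by (auto simp: generic_point_def)

lemma generic_point_subset:
  assumes "generic_point Y p" "Z \<subseteq> Y"
  shows "generic_point Z p"
  unfolding generic_point_def
proof (intro ballI impI)
  fix f assume "f \<in> rat_polys Z" "f p = 0"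
  then show "\<forall>x. f x = 0"
    using generic_pointD[OF assms(1) rat_polys_mono[OF _ assms(2)]] by blast
qed

text \<open>A polynomial function that vanishes at \<open>p\<close> is written in monomials, and its coefficients are
  collected in a formal polynomial \<open>P\<close>. By genericity \<open>P\<close> is zero, hence so are all coefficients.\<close>

lemma generic_imp_generic_point:
  assumes "generic d V p" "finite V"
  shows "generic_point (V \<times> {..<d}) (case_prod p)"
  unfolding generic_point_def
proof (intro ballI impI allI)
  let ?Y = "V \<times> {..<d}"
  fix f x assume f: "f \<in> rat_polys ?Y" and zero: "f (case_prod p) = 0"
  have fin: "finite ?Y" using assms by simp
  from f obtain n where "rat_poly ?Y n f" by (auto simp: rat_polys_def)
  from rat_poly_as_monomials[OF this fin]
  obtain c where c: "\<And>x. f x = (\<Sum>m\<in>exponents ?Y n. of_rat (c m) * monomial ?Y m x)" by blast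
  \<comment> \<open>Exponents are undefined outside ?Y, while formal monomials are zero there.\<close>
  define emb :: "('a \<times> nat \<Rightarrow> nat) \<Rightarrow> 'a \<times> nat \<Rightarrow>\<^sub>0 nat" where
    "emb m = Poly_Mapping.Abs_poly_mapping (\<lambda>y. m y when y \<in> ?Y)" for m
  have look_emb: "Poly_Mapping.lookup (emb m) y = (m y when y \<in> ?Y)" for m y
  proof -
    have "finite {y. (m y when y \<in> ?Y) \<noteq> 0}"
      by (rule finite_subset[OF _ fin]) (auto simp: when_def)
    then show ?thesis by (simp add: emb_def Poly_Mapping.lookup_Abs_poly_mapping)
  qed
  have keys_emb: "Poly_Mapping.keys (emb m) \<subseteq> ?Y" for m
    by (auto simp: in_keys_iff look_emb when_def split: if_splits)
  have restrict_emb: "restrict (Poly_Mapping.lookup (emb m)) ?Y = m" if "m \<in> exponents ?Y n" for m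
    using that by (auto simp: fun_eq_iff look_emb exponents_def PiE_iff extensional_def restrict_def)
  define P where "P = Poly_Mapping.Abs_poly_mapping
    (\<lambda>k. c (restrict (Poly_Mapping.lookup k) ?Y) when k \<in> emb ` exponents ?Y n)"
  have look_P: "Poly_Mapping.lookup P k =
    (c (restrict (Poly_Mapping.lookup k) ?Y) when k \<in> emb ` exponents ?Y n)" for k
  proof -
    have "finite {k. (c (restrict (Poly_Mapping.lookup k) ?Y) when k \<in> emb ` exponents ?Y n) \<noteq> 0}"
      by (rule finite_subset[OF _ finite_imageI[OF finite_exponents[OF fin]], of _ emb n])
         (auto simp: when_def)
    then show ?thesis by (simp add: P_def Poly_Mapping.lookup_Abs_poly_mapping)
  qed
  have look_P_emb: "Poly_Mapping.lookup P (emb m) = c m" if "m \<in> exponents ?Y n" for m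
    using that by (simp add: look_P restrict_emb)
  have keys_P: "Poly_Mapping.keys P \<subseteq> emb ` exponents ?Y n"
    by (auto simp: in_keys_iff look_P when_def split: if_splits)
  have eval: "eval_rat_poly P z = f z" for z
  proof -
    have "eval_rat_poly P z = (\<Sum>k\<in>emb ` exponents ?Y n. of_rat (Poly_Mapping.lookup P k) *
        (\<Prod>x\<in>Poly_Mapping.keys k. z x ^ Poly_Mapping.lookup k x))"
      unfolding eval_rat_poly_def
      by (rule sum.mono_neutral_left)
         (use keys_P fin in \<open>auto simp: in_keys_iff intro!: finite_exponents\<close>)
    also have "\<dots> = (\<Sum>m\<in>exponents ?Y n. of_rat (Poly_Mapping.lookup P (emb m)) *
        (\<Prod>x\<in>Poly_Mapping.keys (emb m). z x ^ Poly_Mapping.lookup (emb m) x))"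
      by (subst sum.reindex) (auto intro!: inj_onI dest: arg_cong[of _ _ "\<lambda>k. restrict (Poly_Mapping.lookup k) ?Y"]
          simp: restrict_emb)
    also have "\<dots> = f z"
      unfolding c
    proof (intro sum.cong refl arg_cong2[where f = "(*)"])
      fix m assume m: "m \<in> exponents ?Y n"
      show "complex_of_rat (Poly_Mapping.lookup P (emb m)) = of_rat (c m)"
        using m by (simp add: look_P_emb)
      have "(\<Prod>x\<in>Poly_Mapping.keys (emb m). z x ^ Poly_Mapping.lookup (emb m) x) =
          (\<Prod>x\<in>?Y. z x ^ Poly_Mapping.lookup (emb m) x)"
        using keys_emb fin by (intro prod.mono_neutral_left) (auto simp: in_keys_iff)
      also have "\<dots> = monomial ?Y m z"
        unfolding monomial_def by (intro prod.cong) (auto simp: look_emb)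
      finally show "(\<Prod>x\<in>Poly_Mapping.keys (emb m). z x ^ Poly_Mapping.lookup (emb m) x) = monomial ?Y m z" .
    qed
    finally show ?thesis .
  qed
  have "(\<lambda>(v, i). p v i) = case_prod p" by auto
  then have "eval_rat_poly P (\<lambda>(v, i). p v i) = 0" using zero eval by simp
  moreover have "\<forall>m\<in>Poly_Mapping.keys P. Poly_Mapping.keys m \<subseteq> ?Y"
    using keys_P keys_emb by blast
  ultimately have "P = 0" using assms(1) unfolding generic_def by blast
  then have "c m = 0" if "m \<in> exponents ?Y n" for m using look_P_emb[OF that] by simp
  then show "f x = 0" by (simp add: c)
qed

text \<open>A linear system with polynomial coefficients that is solvable at one generic point has a solution
  in rational functions; \<open>\<delta>\<close> is a common denominator. The reason is that Gaussian elimination asks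
  only whether certain polynomials vanish at \<open>p\<close>, and at a generic point this means that they vanish
  identically. The resulting identities hold at all points, which is how solvability passes from one
  generic point to another.\<close>

lemma polynomial_solution:
  fixes p :: "'x \<Rightarrow> complex"
  assumes "finite C" "generic_point Y p"
    and "\<And>r c. r \<in> R \<Longrightarrow> c \<in> C \<Longrightarrow> M r c \<in> rat_polys Y"
    and "\<And>r. r \<in> R \<Longrightarrow> b r \<in> rat_polys Y"
    and "\<And>r. r \<in> R \<Longrightarrow> (\<Sum>c\<in>C. M r c p * s c) = b r p"
  shows "\<exists>\<delta> S. \<delta> \<in> rat_polys Y \<and> \<delta> p \<noteq> 0 \<and> (\<forall>c\<in>C. S c \<in> rat_polys Y) \<and>
    (\<forall>r\<in>R. \<forall>x. (\<Sum>c\<in>C. M r c x * S c x) = \<delta> x * b r x)"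
  using assms(1,3-)
proof (induction C arbitrary: M b rule: finite_induct)
  case empty
  then have "b r x = 0" if "r \<in> R" for r x
    using generic_pointD[OF assms(2), of "b r"] that by auto
  then show ?case by (intro exI[of _ "\<lambda>_. 1"]) (auto intro: rat_polys_one)
next
  case (insert c0 C)
  note polM = insert.prems(1) and polb = insert.prems(2) and sol = insert.prems(3)
  show ?case
  proof (cases "\<forall>r\<in>R. M r c0 p = 0")
    case True
    then have "M r c0 x = 0" if "r \<in> R" for r x
      using generic_pointD[OF assms(2)] polM that by blast
    moreover obtain \<delta> S where "\<delta> \<in> rat_polys Y" "\<delta> p \<noteq> 0" "\<forall>c\<in>C. S c \<in> rat_polys Y"
      "\<forall>r\<in>R. \<forall>x. (\<Sum>c\<in>C. M r c x * S c x) = \<delta> x * b r x"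
      using insert.IH[of M b] polM polb sol True insert.hyps by auto
    moreover have "(\<Sum>c\<in>C. M r c x * (S(c0 := \<lambda>_. 0)) c x) = (\<Sum>c\<in>C. M r c x * S c x)" for r x
      using insert.hyps by (intro sum.cong) auto
    ultimately show ?thesis using insert.hyps
      by (intro exI[of _ \<delta>] exI[of _ "S(c0 := \<lambda>_. 0)"]) (simp add: rat_polys_zero)
  next
    case False
    then obtain r0 where r0: "r0 \<in> R" "M r0 c0 p \<noteq> 0" by blast
    \<comment> \<open>Row r0 is the pivot row; cross-multiplication keeps the entries polynomial.\<close>
    define M' where "M' r c x = M r0 c0 x * M r c x - M r c0 x * M r0 c x" for r c x
    define b' where "b' r x = M r0 c0 x * b r x - M r c0 x * b r0 x" for r x
    have "M' r c \<in> rat_polys Y" if "r \<in> R" "c \<in> C" for r c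
      unfolding M'_def using polM that r0 by (intro rat_polys_diff rat_polys_mult) auto
    moreover have "b' r \<in> rat_polys Y" if "r \<in> R" for r
      unfolding b'_def using polM polb that r0 by (intro rat_polys_diff rat_polys_mult) auto
    moreover have "(\<Sum>c\<in>C. M' r c p * s c) = b' r p" if "r \<in> R" for r
    proof -
      have eq: "M r c0 p * s c0 + (\<Sum>c\<in>C. M r c p * s c) = b r p" if "r \<in> R" for r
        using sol[OF that] insert.hyps by simp
      have "(\<Sum>c\<in>C. M' r c p * s c) =
          M r0 c0 p * (\<Sum>c\<in>C. M r c p * s c) - M r c0 p * (\<Sum>c\<in>C. M r0 c p * s c)"
        by (simp add: M'_def left_diff_distrib sum_subtractf sum_distrib_left mult.assoc)
      also have "\<dots> = b' r p"
        unfolding b'_def eq[OF that, symmetric] eq[OF r0(1), symmetric] by (simp add: algebra_simps)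
      finally show ?thesis .
    qed
    ultimately obtain \<delta> S where S: "\<delta> \<in> rat_polys Y" "\<delta> p \<noteq> 0" "\<forall>c\<in>C. S c \<in> rat_polys Y"
      "\<And>r x. r \<in> R \<Longrightarrow> (\<Sum>c\<in>C. M' r c x * S c x) = \<delta> x * b' r x"
      using insert.IH[of M' b'] by blast
    define T where "T = (\<lambda>c x. M r0 c0 x * S c x)
      (c0 := \<lambda>x. \<delta> x * b r0 x - (\<Sum>c\<in>C. M r0 c x * S c x))"
    have "(\<lambda>x. \<delta> x * M r0 c0 x) \<in> rat_polys Y"
      using S polM r0 by (intro rat_polys_mult) auto
    moreover have "T c \<in> rat_polys Y" if "c \<in> insert c0 C" for c
    proof (cases "c = c0")
      case True
      then show ?thesis unfolding T_def fun_upd_def if_P[OF True]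
        using S polM polb r0 by (auto intro!: rat_polys_diff rat_polys_mult rat_polys_sum)
    next
      case False
      then show ?thesis unfolding T_def fun_upd_def if_not_P[OF False]
        using S polM r0 that by (intro rat_polys_mult) auto
    qed
    moreover have "(\<Sum>c\<in>insert c0 C. M r c x * T c x) = \<delta> x * M r0 c0 x * b r x" if "r \<in> R" for r x
    proof -
      have "(\<Sum>c\<in>C. M r c x * T c x) = (\<Sum>c\<in>C. M r c x * (M r0 c0 x * S c x))"
        using insert.hyps by (intro sum.cong) (auto simp: T_def)
      then have "(\<Sum>c\<in>insert c0 C. M r c x * T c x) =
          M r c0 x * (\<delta> x * b r0 x - (\<Sum>c\<in>C. M r0 c x * S c x)) +
          (\<Sum>c\<in>C. M r c x * (M r0 c0 x * S c x))"
        using insert.hyps by (simp add: T_def)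
      also have "\<dots> = M r c0 x * \<delta> x * b r0 x + (\<Sum>c\<in>C. M' r c x * S c x)"
        by (simp add: M'_def algebra_simps sum_subtractf sum_distrib_left)
      also have "\<dots> = \<delta> x * M r0 c0 x * b r x"
        unfolding S(4)[OF that] b'_def by (simp add: algebra_simps)
      finally show ?thesis .
    qed
    ultimately show ?thesis using S(2) r0(2)
      by (intro exI[of _ "\<lambda>x. \<delta> x * M r0 c0 x"] exI[of _ T]) auto
  qed
qed

text \<open>A linear dependence of the differentials \<open>df\<^sub>a\<close> at a generic point persists at all points of the
  fibre. Choose coordinates \<open>x\<^sub>i\<close>, \<open>i \<in> I\<close>, that complete the \<open>df\<^sub>b\<close>, \<open>b \<in> B\<close>, to a basis. Together with
  \<open>f\<^sub>e\<close> these are more functions than variables, so they satisfy a relation \<open>P = 0\<close>; let its degree be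
  least. Differentiating at \<open>p\<close> and comparing with the given dependence shows that \<open>\<partial>P/\<partial>x\<^sub>i\<close> vanishes at
  \<open>p\<close>. As \<open>p\<close> is generic, it vanishes along the image, hence identically because it has smaller degree.
  So \<open>P\<close> is a relation among the \<open>f\<^sub>a\<close> alone. Its partial derivatives, evaluated at \<open>z\<close>, are
  polynomials in \<open>z\<close> that depend on the values \<open>f\<^sub>a(z)\<close> and on \<open>z\<^sub>I\<close>. Differentiating
  \<open>P(f(x), z\<^sub>I) = 0\<close> at any \<open>q\<close> with \<open>f(q) = f(z)\<close> gives the dependence of the differentials at \<open>q\<close>.\<close>

lemma universal_dependency:
  fixes f :: "'a \<Rightarrow> ('x \<Rightarrow> complex) \<Rightarrow> complex" and J :: "'a \<Rightarrow> 'x \<Rightarrow> ('x \<Rightarrow> complex) \<Rightarrow> complex"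
  assumes "finite Y" "finite B" "e \<notin> B" "generic_point Y p"
    and pol: "\<And>a. a \<in> insert e B \<Longrightarrow> rat_poly Y k (f a)"
    and deriv: "\<And>a y z. a \<in> insert e B \<Longrightarrow> y \<in> Y \<Longrightarrow>
      ((\<lambda>t. f a (z(y := t))) has_field_derivative J a y z) (at (z y))"
    and indep: "\<And>c. \<forall>y\<in>Y. (\<Sum>b\<in>B. c b * J b y p) = 0 \<Longrightarrow> \<forall>b\<in>B. c b = 0"
    and dep: "\<And>y. y \<in> Y \<Longrightarrow> (\<Sum>b\<in>B. w b * J b y p) + J e y p = 0"
  shows "\<exists>\<Psi>. (\<forall>a\<in>insert e B. \<Psi> a \<in> rat_polys Y) \<and> \<Psi> e p \<noteq> 0 \<and>
    (\<forall>z q. (\<forall>a\<in>insert e B. f a q = f a z) \<longrightarrow>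
       (\<forall>y\<in>Y. (\<Sum>a\<in>insert e B. \<Psi> a z * J a y q) = 0))"
proof -
  obtain K where K: "K \<subseteq> Y" "card K \<le> card B"
    "\<And>c. \<forall>y\<in>K. (\<Sum>b\<in>B. c b * J b y p) = 0 \<Longrightarrow> \<forall>b\<in>B. c b = 0"
    using independent_rows_on_few_columns[OF assms(2,1), of "\<lambda>b y. J b y p"] indep by blast
  define I where "I = Y - K"
  \<comment> \<open>The variables of the relation: Inl a stands for the function f a, Inr i for the coordinate i.\<close>
  define A where "A = Inl ` insert e B \<union> Inr ` I"
  define h where "h = case_sum f (\<lambda>y x. x y)"
  have finI: "finite I" using assms(1) by (simp add: I_def)
  have finA: "finite A" using assms finI by (simp add: A_def)
  have sum_A: "(\<Sum>a\<in>A. F a) = (\<Sum>a\<in>insert e B. F (Inl a)) + (\<Sum>i\<in>I. F (Inr i))"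
    for F :: "'a + 'x \<Rightarrow> complex"
    unfolding A_def using assms(2) finI
    by (subst sum.union_disjoint) (auto simp: sum.reindex[OF inj_Inl] sum.reindex[OF inj_Inr] simp del: image_insert)
  have card_Y: "card Y < card A"
  proof -
    have "card A = card (insert e B) + card I"
      unfolding A_def using assms(2) finI
      by (subst card_Un_disjoint) (auto simp: card_image[OF inj_Inl] card_image[OF inj_Inr] simp del: image_insert)
    moreover have "card I = card Y - card K"
      unfolding I_def using K(1) assms(1) by (simp add: card_Diff_subset finite_subset)
    ultimately show ?thesis using K(2) assms(2,3) by simp
  qed
  have pol_h: "rat_poly Y (Suc k) (h a)" if "a \<in> A" for a
    using that pol rat_poly_var[of _ Y k] rat_poly_mono_degree[of Y k _ "Suc k"]
    by (auto simp: A_def h_def I_def)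
  define Q where "Q n P \<longleftrightarrow> rat_poly A n P \<and> (\<exists>x. P x \<noteq> 0) \<and> (\<forall>x. P (\<lambda>a. h a x) = 0)" for n P
  define n where "n = (LEAST n. \<exists>P. Q n P)"
  have "\<exists>n P. Q n P"
    using algebraically_dependent[OF assms(1) finA card_Y pol_h] by (auto simp: Q_def)
  then have "\<exists>P. Q n P" unfolding n_def by (rule LeastI_ex)
  then obtain P where P: "rat_poly A n P" "\<exists>x. P x \<noteq> 0" "\<And>x. P (\<lambda>a. h a x) = 0"
    by (auto simp: Q_def)
  obtain D where D: "\<And>a. if n = 0 then D a = (\<lambda>_. 0) else rat_poly A (n - 1) (D a)"
    and chain: "\<And>\<gamma> \<gamma>' t. (\<forall>a\<in>A. (\<gamma> a has_field_derivative \<gamma>' a) (at t)) \<Longrightarrow>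
       ((\<lambda>t. P (\<lambda>a. \<gamma> a t)) has_field_derivative (\<Sum>a\<in>A. D a (\<lambda>a. \<gamma> a t) * \<gamma>' a)) (at t)"
    using rat_poly_chain_rule[OF P(1) finA] by blast
  have pol_D: "rat_poly A (n - 1) (D a)" for a
    using D[of a] rat_poly_const[of A "n - 1" 0] by (cases "n = 0") auto
  have pol_Dh: "(\<lambda>x. D a (\<lambda>a. h a x)) \<in> rat_polys Y" for a
    using pol_h by (intro rat_polys_compose[OF pol_D]) (auto intro: rat_polysI)
  \<comment> \<open>A partial derivative of P that vanishes at p is a relation of smaller degree.\<close>
  have vanish: "D a x = 0" if "D a (\<lambda>a. h a p) = 0" for a x
  proof (cases "n = 0")
    case False
    have "D a (\<lambda>a. h a x) = 0" for x
      by (rule generic_pointD[OF assms(4) pol_Dh[of a] that])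
    moreover have "\<not> Q (n - 1) (D a)"
      using not_less_Least[of "n - 1" "\<lambda>n. \<exists>P. Q n P"] False by (auto simp: n_def)
    ultimately show ?thesis using pol_D by (auto simp: Q_def)
  qed (use D[of a] in simp)
  have const: "P u = P v" if uv: "\<And>a. a \<in> A \<Longrightarrow> u a = v a \<or> (\<forall>x. D a x = 0)" for u v
  proof -
    define \<gamma> where "\<gamma> = (\<lambda>a (t :: complex). u a + t * (v a - u a))"
    have "((\<lambda>t. P (\<lambda>a. \<gamma> a t)) has_field_derivative 0) (at t)" for t
    proof -
      have "\<forall>a\<in>A. (\<gamma> a has_field_derivative (v a - u a)) (at t)"
        unfolding \<gamma>_def by (auto intro!: derivative_eq_intros)
      moreover have "(\<Sum>a\<in>A. D a (\<lambda>a. \<gamma> a t) * (v a - u a)) = 0"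
      proof (intro sum.neutral ballI)
        fix a assume "a \<in> A"
        from uv[OF this] show "D a (\<lambda>a. \<gamma> a t) * (v a - u a) = 0" by auto
      qed
      ultimately show ?thesis using chain[of \<gamma> "\<lambda>a. v a - u a" t] by simp
    qed
    then obtain c where "\<forall>t. P (\<lambda>a. \<gamma> a t) = c"
      using has_field_derivative_zero_constant[of UNIV "\<lambda>t. P (\<lambda>a. \<gamma> a t)"] by auto
    then have "P (\<lambda>a. \<gamma> a 0) = P (\<lambda>a. \<gamma> a 1)" by simp
    then show ?thesis by (simp add: \<gamma>_def)
  qed
  \<comment> \<open>The relation is differentiated at p in the direction of the coordinate y.\<close>
  have relation: "(\<Sum>a\<in>insert e B. D (Inl a) (\<lambda>a. h a p) * J a y p) +
      (if y \<in> I then D (Inr y) (\<lambda>a. h a p) else 0) = 0" if y: "y \<in> Y" for y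
  proof -
    define \<gamma> where "\<gamma> = (\<lambda>a t. h a (p(y := t)))"
    define \<gamma>' where "\<gamma>' = case_sum (\<lambda>a. J a y p) (\<lambda>i. if i = y then 1 else 0)"
    have "\<forall>a\<in>A. (\<gamma> a has_field_derivative \<gamma>' a) (at (p y))"
      using deriv[OF _ y] by (auto simp: A_def \<gamma>_def \<gamma>'_def h_def)
    from chain[OF this]
    have "((\<lambda>t. 0) has_field_derivative (\<Sum>a\<in>A. D a (\<lambda>a. h a p) * \<gamma>' a)) (at (p y))"
      by (simp add: \<gamma>_def P(3))
    from DERIV_unique[OF this DERIV_const]
    have "0 = (\<Sum>a\<in>A. D a (\<lambda>a. h a p) * \<gamma>' a)" by simp
    also have "\<dots> = (\<Sum>a\<in>insert e B. D (Inl a) (\<lambda>a. h a p) * J a y p) +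
        (\<Sum>i\<in>I. if i = y then D (Inr i) (\<lambda>a. h a p) else 0)"
      unfolding sum_A by (simp add: \<gamma>'_def if_distrib cong: if_cong)
    also have "(\<Sum>i\<in>I. if i = y then D (Inr i) (\<lambda>a. h a p) else 0) =
        (if y \<in> I then D (Inr y) (\<lambda>a. h a p) else 0)"
      using finI by simp
    finally show ?thesis by simp
  qed
  let ?De = "D (Inl e) (\<lambda>a. h a p)"
  have De_split: "(\<Sum>a\<in>insert e B. D (Inl a) (\<lambda>a. h a p) * J a y p) =
      (\<Sum>b\<in>B. (D (Inl b) (\<lambda>a. h a p) - ?De * w b) * J b y p)" if y: "y \<in> Y" for y
  proof -
    have "J e y p = - (\<Sum>b\<in>B. w b * J b y p)" using dep[OF y] by (simp add: add_eq_0_iff)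
    then show ?thesis
      using assms(2,3) by (simp add: left_diff_distrib sum_subtractf sum_distrib_left mult.assoc)
  qed
  have "\<forall>y\<in>K. (\<Sum>b\<in>B. (D (Inl b) (\<lambda>a. h a p) - ?De * w b) * J b y p) = 0"
  proof
    fix y assume "y \<in> K"
    then have "y \<in> Y" "y \<notin> I" using K(1) by (auto simp: I_def)
    then show "(\<Sum>b\<in>B. (D (Inl b) (\<lambda>a. h a p) - ?De * w b) * J b y p) = 0"
      using relation[of y] De_split[of y] by simp
  qed
  from K(3)[OF this] have Db: "D (Inl b) (\<lambda>a. h a p) = ?De * w b" if "b \<in> B" for b
    using that by auto
  have DI: "D (Inr i) x = 0" if "i \<in> I" for i x
  proof (rule vanish)
    have i: "i \<in> Y" using that by (simp add: I_def)
    show "D (Inr i) (\<lambda>a. h a p) = 0"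
      using relation[OF i] that unfolding De_split[OF i] by (simp add: Db)
  qed
  \<comment> \<open>Otherwise all partial derivatives vanish, and P is constant.\<close>
  have De: "?De \<noteq> 0"
  proof
    assume "?De = 0"
    then have "D a x = 0" if "a \<in> A" for a x
      using that Db DI vanish by (auto simp: A_def)
    then have "P x = P (\<lambda>a. h a p)" for x by (intro const) auto
    then show False using P(2,3) by simp
  qed
  define \<Psi> where "\<Psi> a z = D (Inl a) (\<lambda>a. h a z)" for a z
  have "(\<Sum>a\<in>insert e B. \<Psi> a z * J a y q) = 0"
    if same: "\<forall>a\<in>insert e B. f a q = f a z" and y: "y \<in> Y" for z q y
  proof -
    \<comment> \<open>The coordinates in I are frozen at z, which does not change the value of P.\<close>
    define G where "G x = case_sum (\<lambda>a. f a x) z" for x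
    have P_G: "P (G x) = 0" for x
    proof -
      have "P (G x) = P (\<lambda>a. h a x)"
        using DI by (intro const) (auto simp: A_def G_def h_def)
      then show ?thesis by (simp add: P(3))
    qed
    define \<gamma> where "\<gamma> = (\<lambda>a t. G (q(y := t)) a)"
    define \<gamma>' where "\<gamma>' = case_sum (\<lambda>a. J a y q) (\<lambda>i :: 'x. 0)"
    have "\<forall>a\<in>A. (\<gamma> a has_field_derivative \<gamma>' a) (at (q y))"
      using deriv[OF _ y] by (auto simp: A_def \<gamma>_def \<gamma>'_def G_def)
    from chain[OF this]
    have "((\<lambda>t. 0) has_field_derivative (\<Sum>a\<in>A. D a (G q) * \<gamma>' a)) (at (q y))"
      by (simp add: \<gamma>_def P_G)
    from DERIV_unique[OF this DERIV_const]
    have "(\<Sum>a\<in>insert e B. D (Inl a) (G q) * J a y q) = 0"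
      unfolding sum_A by (simp add: \<gamma>'_def)
    moreover have "D (Inl a) (G q) = \<Psi> a z" for a
      unfolding \<Psi>_def using same
      by (intro rat_poly_cong[OF pol_D]) (auto simp: A_def G_def h_def)
    ultimately show ?thesis by simp
  qed
  moreover have "\<Psi> a \<in> rat_polys Y" for a unfolding \<Psi>_def by (rule pol_Dh)
  moreover have "\<Psi> e p \<noteq> 0" using De by (simp add: \<Psi>_def)
  ultimately show ?thesis by (intro exI[of _ \<Psi>]) blast
qed

section \<open>The Jacobian of the measurement map\<close>

definition pairs :: "'v set \<Rightarrow> 'v set set" where
  "pairs X = {e. e \<subseteq> X \<and> card e = 2}"

lemma finite_pairs: "finite X \<Longrightarrow> finite (pairs X)"
  by (rule finite_subset[of _ "Pow X"]) (auto simp: pairs_def)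

lemma card_pairs: "finite X \<Longrightarrow> card (pairs X) = card X choose 2"
  unfolding pairs_def by (rule n_subsets)

lemma pairsE:
  assumes "e \<in> pairs X"
  obtains u v where "u \<in> X" "v \<in> X" "u \<noteq> v" "e = {u, v}"
  using assms by (auto simp: pairs_def card_2_iff)

lemma doubleton_in_pairs: "{u, v} \<in> pairs X \<longleftrightarrow> u \<in> X \<and> v \<in> X \<and> u \<noteq> v"
  by (auto simp: pairs_def card_2_iff doubleton_eq_iff)

lemma jacobian_row_edge:
  fixes p :: "'v config"
  assumes "u \<noteq> v" "i < d"
  defines "R \<equiv> \<lambda>w. if w = u then 2 * (p u i - p v i) else if w = v then 2 * (p v i - p u i) else 0"
  shows "((\<lambda>t. measurement d (p(w := (p w)(i := t))) {u, v}) has_field_derivative R w) (at (p w i))"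
    and "jacobian_row d p {u, v} (w, i) = R w"
proof -
  let ?p = "\<lambda>t. p(w := (p w)(i := t))"
  have "((\<lambda>t. (?p t u j - ?p t v j)\<^sup>2) has_field_derivative (if j = i then R w else 0)) (at (p w i))"
    for j
    using assms(1) by (auto simp: R_def intro!: derivative_eq_intros)
  then have "((\<lambda>t. \<Sum>j<d. (?p t u j - ?p t v j)\<^sup>2) has_field_derivative
      (\<Sum>j<d. if j = i then R w else 0)) (at (p w i))"
    by (intro DERIV_sum) blast
  also have "(\<Sum>j<d. if j = i then R w else 0) = R w" using assms(2) by simp
  finally show deriv:
    "((\<lambda>t. measurement d (?p t) {u, v}) has_field_derivative R w) (at (p w i))"
    unfolding measurement_edge sq_len_def .
  show "jacobian_row d p {u, v} (w, i) = R w"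
    unfolding jacobian_row_def using DERIV_imp_deriv[OF deriv] by simp
qed

lemma rat_poly_measurement:
  assumes "e \<in> pairs X"
  shows "rat_poly (X \<times> {..<d}) 2 (\<lambda>x. measurement d (curry x) e)"
proof -
  obtain u v where uv: "u \<in> X" "v \<in> X" "e = {u, v}" using pairsE[OF assms] by metis
  let ?Y = "X \<times> {..<d}"
  have "rat_poly ?Y 2 (\<lambda>x. (x (u, i) - x (v, i))\<^sup>2)" if "i < d" for i
  proof -
    have "rat_poly ?Y (0 + Suc 0) (\<lambda>x. of_rat (- 1) * x (v, i))"
      using uv that by (intro rat_poly_mult rat_poly_const rat_poly_var) auto
    then have "rat_poly ?Y 1 (\<lambda>x. x (u, i) + of_rat (- 1) * x (v, i))"
      using uv that rat_poly_var[of "(u, i)" ?Y 0] by (intro rat_poly_add) auto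
    from rat_poly_power[OF this, of 2] show ?thesis by (simp add: of_rat_minus)
  qed
  then show ?thesis
    unfolding uv measurement_edge sq_len_def curry_def by (intro rat_poly_sum) auto
qed

lemma measurement_derivative:
  assumes "e \<in> pairs X" "y \<in> X \<times> {..<d}"
  shows "((\<lambda>t. measurement d (curry (z(y := t))) e) has_field_derivative
           jacobian_row d (curry z) e y) (at (z y))"
proof -
  obtain u v where uv: "u \<noteq> v" "e = {u, v}" using pairsE[OF assms(1)] by metis
  obtain w i where y: "y = (w, i)" "i < d" using assms(2) by auto
  have "curry (z(y := t)) = (curry z)(w := (curry z w)(i := t))" for t
    by (auto simp: y fun_eq_iff)
  then show ?thesis
    using jacobian_row_edge[OF uv(1) y(2), where p = "curry z" and w = w] by (simp add: y uv)
qed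

lemma jacobian_row_pairing:
  assumes "finite X" "u \<in> X" "v \<in> X" "u \<noteq> v" "i < d"
  shows "(\<Sum>w\<in>X. jacobian_row d p {u, v} (w, i) * g w) = 2 * (p u i - p v i) * (g u - g v)"
proof -
  have "(\<Sum>w\<in>X. jacobian_row d p {u, v} (w, i) * g w) =
      (\<Sum>w\<in>{u, v}. jacobian_row d p {u, v} (w, i) * g w)"
    using assms jacobian_row_edge(2)[OF assms(4,5), of p]
    by (intro sum.mono_neutral_right) auto
  then show ?thesis
    using assms(4) by (simp add: jacobian_row_edge(2)[OF assms(4,5)] algebra_simps)
qed

text \<open>Euler's identity for a homogeneous function of degree two.\<close>

lemma euler_measurement:
  assumes "finite X" "e \<in> pairs X"
  shows "(\<Sum>(w, i)\<in>X \<times> {..<d}. jacobian_row d p e (w, i) * p w i) = 2 * measurement d p e"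
proof -
  obtain u v where uv: "u \<in> X" "v \<in> X" "u \<noteq> v" "e = {u, v}" using pairsE[OF assms(2)] by metis
  have "(\<Sum>(w, i)\<in>X \<times> {..<d}. jacobian_row d p e (w, i) * p w i) =
      (\<Sum>i<d. \<Sum>w\<in>X. jacobian_row d p e (w, i) * p w i)"
    by (subst sum.cartesian_product[symmetric]) (rule sum.swap)
  also have "\<dots> = (\<Sum>i<d. 2 * (p u i - p v i)\<^sup>2)"
    using uv assms(1) by (intro sum.cong) (auto simp: jacobian_row_pairing power2_eq_square)
  finally show ?thesis
    by (simp add: uv measurement_edge sq_len_def sum_distrib_left)
qed

section \<open>Stress matrices\<close>

text \<open>The Laplacian of the weighted graph with edge weights \<open>\<omega>\<close>.\<close>

definition stress_matrix :: "'v set \<Rightarrow> ('v set \<Rightarrow> complex) \<Rightarrow> 'v \<Rightarrow> 'v \<Rightarrow> complex" where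
  "stress_matrix X \<omega> w v = (if v = w then (\<Sum>u\<in>X - {w}. \<omega> {w, u}) else - \<omega> {w, v})"

lemma stress_matrix_sym: "stress_matrix X \<omega> w v = stress_matrix X \<omega> v w"
  by (auto simp: stress_matrix_def insert_commute)

lemma stress_matrix_apply:
  assumes "finite X" "w \<in> X"
  shows "(\<Sum>v\<in>X. stress_matrix X \<omega> w v * g v) = (\<Sum>u\<in>X - {w}. \<omega> {w, u} * (g w - g u))"
proof -
  have "(\<Sum>v\<in>X. stress_matrix X \<omega> w v * g v) =
      (\<Sum>u\<in>X - {w}. \<omega> {w, u}) * g w + (\<Sum>v\<in>X - {w}. - \<omega> {w, v} * g v)"
    using assms by (subst sum.remove[of X w]) (auto simp: stress_matrix_def intro!: sum.cong)
  then show ?thesis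
    by (simp add: sum_distrib_right right_diff_distrib sum_subtractf sum_negf)
qed

definition stress :: "nat \<Rightarrow> 'v set \<Rightarrow> ('v \<times> nat \<Rightarrow> complex) \<Rightarrow> ('v set \<Rightarrow> complex) \<Rightarrow> bool" where
  "stress d X x \<omega> \<longleftrightarrow>
     (\<forall>y\<in>X \<times> {..<d}. (\<Sum>a\<in>pairs X. \<omega> a * jacobian_row d (curry x) a y) = 0)"

lemma stress_combination:
  assumes "stress d X x \<omega>" "stress d X x \<omega>'"
  shows "stress d X x (\<lambda>a. \<alpha> * \<omega> a + \<beta> * \<omega>' a)"
proof -
  have "(\<Sum>a\<in>pairs X. (\<alpha> * \<omega> a + \<beta> * \<omega>' a) * R a) =
      \<alpha> * (\<Sum>a\<in>pairs X. \<omega> a * R a) + \<beta> * (\<Sum>a\<in>pairs X. \<omega>' a * R a)" for R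
    by (simp add: sum.distrib sum_distrib_left algebra_simps)
  then show ?thesis using assms by (simp add: stress_def)
qed

text \<open>Column \<open>(w, i)\<close> of a combination of Jacobian rows only involves the pairs that contain \<open>w\<close>, so it is
  twice the row \<open>w\<close> of the Laplacian applied to the \<open>i\<close>-th coordinates.\<close>

lemma stress_iff_stress_matrix:
  assumes "finite X"
  shows "stress d X x \<omega> \<longleftrightarrow>
    (\<forall>w\<in>X. \<forall>i<d. (\<Sum>v\<in>X. stress_matrix X \<omega> w v * x (v, i)) = 0)"
proof -
  have "(\<Sum>a\<in>pairs X. \<omega> a * jacobian_row d (curry x) a (w, i)) =
      2 * (\<Sum>v\<in>X. stress_matrix X \<omega> w v * x (v, i))" if w: "w \<in> X" and i: "i < d" for w i
  proof -
    let ?star = "(\<lambda>u. {w, u}) ` (X - {w})"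
    have "(\<Sum>a\<in>pairs X. \<omega> a * jacobian_row d (curry x) a (w, i)) =
        (\<Sum>a\<in>?star. \<omega> a * jacobian_row d (curry x) a (w, i))"
    proof (intro sum.mono_neutral_right ballI)
      show "?star \<subseteq> pairs X" using w by (auto simp: doubleton_in_pairs)
      fix a assume a: "a \<in> pairs X - ?star"
      then obtain u v where uv: "u \<in> X" "v \<in> X" "u \<noteq> v" "a = {u, v}" using pairsE[of a X] by auto
      with a have "w \<noteq> u" "w \<noteq> v" by (auto simp: insert_commute)
      then show "\<omega> a * jacobian_row d (curry x) a (w, i) = 0"
        using jacobian_row_edge(2)[of u v i d "curry x" w] i uv by simp
    qed (simp add: assms finite_pairs)
    also have "\<dots> = (\<Sum>u\<in>X - {w}. \<omega> {w, u} * jacobian_row d (curry x) {w, u} (w, i))"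
      by (subst sum.reindex) (auto simp: inj_on_def doubleton_eq_iff)
    also have "\<dots> = (\<Sum>u\<in>X - {w}. 2 * (\<omega> {w, u} * (x (w, i) - x (u, i))))"
      using i by (intro sum.cong) (auto simp: jacobian_row_edge(2))
    finally show ?thesis
      by (simp add: stress_matrix_apply[OF assms w] sum_distrib_left)
  qed
  then show ?thesis by (auto simp: stress_def)
qed

text \<open>The coordinates of \<open>x\<close> are themselves a test vector for the equilibrium condition; by Euler's
  identity a Jacobian row takes the value twice the squared length on it.\<close>

lemma stress_euler:
  assumes "finite X" "stress d X x \<omega>"
  shows "(\<Sum>a\<in>pairs X. \<omega> a * measurement d (curry x) a) = 0"
proof -
  have "2 * (\<Sum>a\<in>pairs X. \<omega> a * measurement d (curry x) a) =
      (\<Sum>a\<in>pairs X. \<omega> a * (\<Sum>y\<in>X \<times> {..<d}. jacobian_row d (curry x) a y * x y))"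
    unfolding sum_distrib_left
  proof (rule sum.cong)
    fix a assume "a \<in> pairs X"
    from euler_measurement[OF assms(1) this, of d "curry x"]
    show "2 * (\<omega> a * measurement d (curry x) a) =
        (\<Sum>y\<in>X \<times> {..<d}. \<omega> a * (jacobian_row d (curry x) a y * x y))"
      by (simp add: case_prod_unfold sum_distrib_left[symmetric])
  qed simp
  also have "\<dots> = (\<Sum>y\<in>X \<times> {..<d}. (\<Sum>a\<in>pairs X. \<omega> a * jacobian_row d (curry x) a y) * x y)"
    by (simp add: sum_distrib_left sum_distrib_right mult.assoc) (rule sum.swap)
  also have "\<dots> = 0"
    using assms(2) unfolding stress_def by (intro sum.neutral ballI) (metis mult_zero_left)
  finally show ?thesis by simp
qed

section \<open>Affine dependences of generic points\<close>

text \<open>General position of generic points, in a form that also covers projections to the first \<open>k\<close>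
  coordinates; this makes the induction work. In the induction step, a point \<open>u\<close> is an affine
  combination of the others. By the induction hypothesis the coefficients are determined by the first
  \<open>k\<close> coordinates, so they are rational functions of coordinates other than \<open>(u, k)\<close>. Then the equation
  for the coordinate \<open>k\<close> expresses \<open>x (u, k)\<close> through the other coordinates, which a generic point does
  not allow.\<close>

lemma generic_affinely_independent:
  assumes "finite V" "generic_point (V \<times> {..<d}) x"
    and "U \<subseteq> V" "card U \<le> k + 1" "k \<le> d"
    and "(\<Sum>u\<in>U. l u) = 0" "\<And>i. i < k \<Longrightarrow> (\<Sum>u\<in>U. l u * x (u, i)) = 0"
    and "u \<in> U"
  shows "l u = 0"
  using assms(3-)
proof (induction k arbitrary: U l u)
  case 0
  have "finite U" using "0.prems" assms(1) finite_subset by blast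
  with 0 have "U = {u}" by (auto simp: card_le_Suc0_iff_eq)
  with 0 show ?case by simp
next
  case (Suc k)
  have fin: "finite U" using Suc.prems assms(1) finite_subset by blast
  show ?case
  proof (rule ccontr)
    assume lu: "l u \<noteq> 0"
    define W where "W = U - {u}"
    have W: "W \<subseteq> V" "finite W" "card W \<le> k + 1" "u \<notin> W"
      using Suc.prems fin by (auto simp: W_def)
    have split: "(\<Sum>v\<in>U. F v) = F u + (\<Sum>v\<in>W. F v)" for F :: "'a \<Rightarrow> complex"
      unfolding W_def using fin Suc.prems by (simp add: sum.remove)
    define \<mu> where "\<mu> v = - l v / l u" for v
    have \<mu>_sum: "(\<Sum>v\<in>W. \<mu> v) = 1"
      using Suc.prems(4) lu
      by (simp add: split \<mu>_def sum_negf sum_divide_distrib[symmetric] field_simps add_eq_0_iff)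
    have \<mu>_coord: "(\<Sum>v\<in>W. \<mu> v * x (v, i)) = x (u, i)" if "i < Suc k" for i
    proof -
      have "(\<Sum>v\<in>W. \<mu> v * x (v, i)) = - (\<Sum>v\<in>W. l v * x (v, i)) / l u"
        by (simp add: \<mu>_def sum_negf sum_divide_distrib[symmetric])
      also have "\<dots> = x (u, i)"
        using Suc.prems(5)[OF that] lu by (simp add: split add_eq_0_iff field_simps)
      finally show ?thesis .
    qed
    let ?Z = "V \<times> {..<d} - {(u, k)}"
    \<comment> \<open>None is the equation for the sum of the coefficients, Some i the one for the coordinate i.\<close>
    define M where "M r v y = (case r of None \<Rightarrow> 1 | Some i \<Rightarrow> y (v, i))"
      for r and v :: 'a and y :: "'a \<times> nat \<Rightarrow> complex"
    let ?R = "insert None (Some ` {..<k})"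
    have Z: "(v, i) \<in> ?Z" if "v \<in> U" "i < k" for v i
      using that Suc.prems by auto
    have gen: "generic_point ?Z x" by (rule generic_point_subset[OF assms(2)]) auto
    have pol: "(\<lambda>y. M r v y) \<in> rat_polys ?Z" if "r \<in> ?R" "v \<in> U" for r v
      using that Z by (auto simp: M_def rat_polys_one intro!: rat_polys_var)
    have sol: "(\<Sum>v\<in>W. M r v x * \<mu> v) = M r u x" if "r \<in> ?R" for r
      using that \<mu>_sum \<mu>_coord by (auto simp: M_def mult.commute)
    have "W \<subseteq> U" "u \<in> U" using Suc.prems by (auto simp: W_def)
    then have "\<exists>\<delta> S. \<delta> \<in> rat_polys ?Z \<and> \<delta> x \<noteq> 0 \<and> (\<forall>v\<in>W. S v \<in> rat_polys ?Z) \<and>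
        (\<forall>r\<in>?R. \<forall>y. (\<Sum>v\<in>W. M r v y * S v y) = \<delta> y * M r u y)"
      using pol sol by (intro polynomial_solution[OF W(2) gen, where s = \<mu>]) blast+
    then obtain \<delta> S where S: "\<delta> \<in> rat_polys ?Z" "\<delta> x \<noteq> 0" "\<forall>v\<in>W. S v \<in> rat_polys ?Z"
      "\<forall>r\<in>?R. \<forall>y. (\<Sum>v\<in>W. M r v y * S v y) = \<delta> y * M r u y"
      by blast
    have uniq: "S v x = \<delta> x * \<mu> v" if "v \<in> W" for v
    proof -
      have "S v x - \<delta> x * \<mu> v = 0"
      proof (rule Suc.IH[OF W(1,3) _ _ _ that])
        show "k \<le> d" using Suc.prems by simp
        have "(\<Sum>v\<in>W. S v x) = \<delta> x" using S(4) by (auto simp: M_def)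
        then show "(\<Sum>v\<in>W. S v x - \<delta> x * \<mu> v) = 0"
          by (simp add: sum_subtractf sum_distrib_left[symmetric] \<mu>_sum)
        fix i assume i: "i < k"
        have "(\<Sum>v\<in>W. x (v, i) * S v x) = \<delta> x * x (u, i)"
          using S(4) i by (auto simp: M_def)
        then show "(\<Sum>v\<in>W. (S v x - \<delta> x * \<mu> v) * x (v, i)) = 0"
          using \<mu>_coord[of i] i
          by (simp add: left_diff_distrib sum_subtractf mult.assoc sum_distrib_left[symmetric]
              mult.commute[of "S _ _"])
      qed
      then show ?thesis by simp
    qed
    define f where "f y = (\<Sum>v\<in>W. S v y * y (v, k)) - \<delta> y * y (u, k)" for y
    have "f \<in> rat_polys (V \<times> {..<d})"
      unfolding f_def
    proof (intro rat_polys_diff rat_polys_sum rat_polys_mult)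
      have k: "(v, k) \<in> V \<times> {..<d}" if "v \<in> U" for v using that Suc.prems by auto
      show "\<delta> \<in> rat_polys (V \<times> {..<d})" by (rule rat_polys_mono[OF S(1)]) auto
      show "(\<lambda>y. y (u, k)) \<in> rat_polys (V \<times> {..<d})"
        by (rule rat_polys_var) (use k \<open>u \<in> U\<close> in blast)
      fix v assume v: "v \<in> W"
      show "S v \<in> rat_polys (V \<times> {..<d})" by (rule rat_polys_mono[of _ ?Z]) (use S(3) v in auto)
      show "(\<lambda>y. y (v, k)) \<in> rat_polys (V \<times> {..<d})"
        by (rule rat_polys_var) (use k v \<open>W \<subseteq> U\<close> in blast)
    qed
    moreover have "f x = 0"
      using \<mu>_coord[of k] by (simp add: f_def uniq mult.assoc sum_distrib_left[symmetric])
    ultimately have zero: "f y = 0" for y using generic_pointD[OF assms(2)] by blast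
    \<comment> \<open>The relation f = 0 is linear in the coordinate (u, k), with coefficient - \<delta> x.\<close>
    define x' where "x' = x((u, k) := x (u, k) + 1)"
    have "\<delta> x' = \<delta> x"
      by (rule rat_polys_cong[OF S(1)]) (auto simp: x'_def)
    moreover have "S v x' * x' (v, k) = S v x * x (v, k)" if v: "v \<in> W" for v
    proof -
      have "S v \<in> rat_polys ?Z" using S(3) v by blast
      then have "S v x' = S v x" by (rule rat_polys_cong) (auto simp: x'_def)
      moreover have "v \<noteq> u" using v W(4) by blast
      ultimately show ?thesis by (simp add: x'_def)
    qed
    then have "(\<Sum>v\<in>W. S v x' * x' (v, k)) = (\<Sum>v\<in>W. S v x * x (v, k))"
      by (intro sum.cong) auto
    moreover have "x' (u, k) = x (u, k) + 1" by (simp add: x'_def)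
    ultimately have "f x' = f x - \<delta> x"
      by (simp add: f_def algebra_simps)
    then show False using zero S(2) by simp
  qed
qed

definition affine_dependence :: "nat \<Rightarrow> 'v set \<Rightarrow> ('v \<times> nat \<Rightarrow> complex) \<Rightarrow> ('v \<Rightarrow> complex) \<Rightarrow> bool" where
  "affine_dependence d X x l \<longleftrightarrow>
     (\<Sum>v\<in>X. l v) = 0 \<and> (\<forall>i<d. (\<Sum>v\<in>X. l v * x (v, i)) = 0)"

lemma affine_dependence_support:
  assumes "finite X" "generic_point (X \<times> {..<d}) x" "affine_dependence d X x l"
    and "u \<in> X" "l u \<noteq> 0"
  shows "d + 2 \<le> card {v \<in> X. l v \<noteq> 0}"
proof (rule ccontr)
  let ?U = "{v \<in> X. l v \<noteq> 0}"
  assume "\<not> ?thesis"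
  then have card: "card ?U \<le> d + 1" by simp
  have "(\<Sum>v\<in>?U. l v * g v) = (\<Sum>v\<in>X. l v * g v)" for g
    using assms(1) by (intro sum.mono_neutral_left) auto
  from this[of "\<lambda>_. 1"] this
  have sum: "(\<Sum>v\<in>?U. l v) = 0" and coord: "\<And>i. i < d \<Longrightarrow> (\<Sum>v\<in>?U. l v * x (v, i)) = 0"
    using assms(3) by (simp_all add: affine_dependence_def)
  have "l u = 0"
    by (rule generic_affinely_independent[OF assms(1,2) _ card order.refl sum coord])
       (use assms(4,5) in auto)
  then show False using assms(5) by simp
qed

lemma stress_matrix_row_affine_dependence:
  assumes "finite X" "stress d X x \<omega>" "w \<in> X"
  shows "affine_dependence d X x (stress_matrix X \<omega> w)"
  using assms stress_matrix_apply[OF assms(1,3), of \<omega> "\<lambda>_. 1"]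
  by (simp add: affine_dependence_def stress_iff_stress_matrix)

text \<open>The space of affine dependences has dimension at most \<open>card X - d - 1\<close>: a combination that vanishes
  outside a set of \<open>d + 1\<close> points is an affine dependence with too small a support.\<close>

lemma affine_dependences_linearly_dependent:
  assumes "finite X" "generic_point (X \<times> {..<d}) x" "d + 1 \<le> card X"
    and "finite J" "card X < card J + d + 1"
    and "\<And>j. j \<in> J \<Longrightarrow> affine_dependence d X x (l j)"
  shows "\<exists>c. (\<exists>j\<in>J. c j \<noteq> 0) \<and> (\<forall>u\<in>X. (\<Sum>j\<in>J. c j * l j u) = 0)"
proof -
  obtain U where U: "U \<subseteq> X" "card U = d + 1" using obtain_subset_with_card_n[OF assms(3)] by blast
  have "card (X - U) < card J"
    using U assms by (subst card_Diff_subset) (auto simp: finite_subset)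
  from homogeneous_system_nontrivial[OF _ assms(4) this, of "\<lambda>u j. l j u"] assms(1)
  obtain c where c: "\<exists>j\<in>J. c j \<noteq> 0" "\<And>u. u \<in> X - U \<Longrightarrow> (\<Sum>j\<in>J. c j * l j u) = 0"
    by (auto simp: mult.commute)
  define L where "L u = (\<Sum>j\<in>J. c j * l j u)" for u
  have pair: "(\<Sum>u\<in>X. L u * g u) = (\<Sum>j\<in>J. c j * (\<Sum>u\<in>X. l j u * g u))" for g
    unfolding L_def by (simp add: sum_distrib_left sum_distrib_right mult.assoc) (rule sum.swap)
  have "affine_dependence d X x L"
    using assms(6) pair[of "\<lambda>_. 1"] pair by (simp add: affine_dependence_def)
  moreover have "card {u \<in> X. L u \<noteq> 0} < d + 2"
  proof -
    have "{u \<in> X. L u \<noteq> 0} \<subseteq> U" using c(2) by (auto simp: L_def)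
    from card_mono[OF finite_subset[OF U(1) assms(1)] this] show ?thesis using U(2) by simp
  qed
  ultimately have "L u = 0" if "u \<in> X" for u
    using affine_dependence_support[OF assms(1,2)] that not_le by blast
  then show ?thesis using c(1) by (auto simp: L_def)
qed

text \<open>Every combination \<open>\<rho>\<close> of Jacobian rows is orthogonal to the infinitesimal translations and
  rotations. Pin \<open>d\<close> points \<open>g 0, g 1, \<dots>\<close>, the point \<open>g j\<close> in its coordinates \<open>i \<ge> j\<close>. If \<open>\<rho>\<close> vanishes at
  all columns that are not pinned, then it vanishes. For the coordinates are treated in increasing
  order: in coordinate \<open>i\<close> only the \<open>i + 1\<close> points \<open>g 0, \<dots>, g i\<close> may carry non-zero values, and the
  rotations in the planes of \<open>i\<close> and a smaller coordinate turn these values into an affine dependence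
  of the points in their first \<open>i\<close> coordinates. So independent rows cannot outnumber the columns that
  are not pinned.\<close>

lemma independent_rows_bound:
  assumes "finite X" "generic_point (X \<times> {..<d}) x" "d \<le> card X"
    and "B \<subseteq> pairs X" "rows_independent d X (curry x) B"
  shows "card B + ((d + 1) choose 2) \<le> d * card X"
proof (rule ccontr)
  assume contra: "\<not> ?thesis"
  obtain g where g: "g ` {..<d} \<subseteq> X" "inj_on g {..<d}"
    using card_le_inj[of "{..<d}" X] assms(1,3) by auto
  let ?T = "SIGMA i:{..<d}. {..i}"
  let ?pin = "\<lambda>(i, j). (g j, i)"
  have inj: "inj_on ?pin ?T"
    using g(2) by (auto simp: inj_on_def)
  have "card ?T = (d + 1) choose 2"
  proof -
    have "card ?T = (\<Sum>i<d. i + 1)" by simp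
    also have "\<dots> = (d + 1) choose 2" by (induction d) (auto simp: numeral_2_eq_2)
    finally show ?thesis .
  qed
  then have card_pin: "card (?pin ` ?T) = (d + 1) choose 2" using inj by (simp add: card_image)
  have pin_sub: "?pin ` ?T \<subseteq> X \<times> {..<d}" using g(1) by auto
  have finB: "finite B" using assms(1,4) finite_pairs finite_subset by blast
  have "card (X \<times> {..<d} - ?pin ` ?T) < card B"
  proof -
    have "card (X \<times> {..<d} - ?pin ` ?T) = d * card X - ((d + 1) choose 2)"
      using pin_sub assms(1) by (subst card_Diff_subset) (auto simp: card_pin finite_subset mult.commute)
    moreover have "(d + 1) choose 2 \<le> d * card X"
      using card_mono[OF _ pin_sub] assms(1) by (simp add: card_pin mult.commute)
    ultimately show ?thesis using contra by simp
  qed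
  from homogeneous_system_nontrivial[OF _ finB this, of "\<lambda>y b. jacobian_row d (curry x) b y"] assms(1)
  obtain c where c: "\<exists>b\<in>B. c b \<noteq> 0"
    "\<And>y. y \<in> X \<times> {..<d} - ?pin ` ?T \<Longrightarrow> (\<Sum>b\<in>B. c b * jacobian_row d (curry x) b y) = 0"
    by (auto simp: mult.commute)
  define \<rho> where "\<rho> w i = (\<Sum>b\<in>B. c b * jacobian_row d (curry x) b (w, i))" for w i
  have pair: "(\<Sum>w\<in>X. \<rho> w i * h w) =
      (\<Sum>b\<in>B. c b * (\<Sum>w\<in>X. jacobian_row d (curry x) b (w, i) * h w))" for i h
    unfolding \<rho>_def by (simp add: sum_distrib_left sum_distrib_right mult.assoc) (rule sum.swap)
  have translation: "(\<Sum>w\<in>X. \<rho> w i) = 0" if "i < d" for i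
  proof -
    have "(\<Sum>w\<in>X. jacobian_row d (curry x) b (w, i) * 1) = 0" if "b \<in> B" for b
    proof -
      obtain u v where "u \<in> X" "v \<in> X" "u \<noteq> v" "b = {u, v}"
        using pairsE[of b X] \<open>b \<in> B\<close> assms(4) by blast
      then show ?thesis
        using jacobian_row_pairing[OF assms(1) _ _ _ \<open>i < d\<close>, of u v "curry x" "\<lambda>_. 1"] by simp
    qed
    then show ?thesis using pair[of i "\<lambda>_. 1"] by simp
  qed
  have rotation: "(\<Sum>w\<in>X. \<rho> w i * x (w, j)) = (\<Sum>w\<in>X. \<rho> w j * x (w, i))"
    if "i < d" "j < d" for i j
  proof -
    have "(\<Sum>w\<in>X. jacobian_row d (curry x) b (w, i) * x (w, j)) =
        (\<Sum>w\<in>X. jacobian_row d (curry x) b (w, j) * x (w, i))" if "b \<in> B" for b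
    proof -
      obtain u v where uv: "u \<in> X" "v \<in> X" "u \<noteq> v" "b = {u, v}"
        using pairsE[of b X] assms(4) \<open>b \<in> B\<close> by blast
      show ?thesis
        unfolding uv(4) jacobian_row_pairing[OF assms(1) uv(1-3) \<open>i < d\<close>]
          jacobian_row_pairing[OF assms(1) uv(1-3) \<open>j < d\<close>]
        by (simp add: algebra_simps)
    qed
    then show ?thesis unfolding pair by (intro sum.cong) auto
  qed
  have "\<forall>w\<in>X. \<rho> w i = 0" if "i < d" for i
    using that
  proof (induction i rule: less_induct)
    case (less i)
    let ?U = "g ` {..i}"
    have outside: "\<rho> w i = 0" if "w \<in> X - ?U" for w
    proof -
      have "(w, i) \<in> X \<times> {..<d} - ?pin ` ?T" using that less.prems by auto
      from c(2)[OF this] show ?thesis by (simp add: \<rho>_def)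
    qed
    have U: "?U \<subseteq> X" using g(1) less.prems by auto
    have to_U: "(\<Sum>w\<in>?U. \<rho> w i * h w) = (\<Sum>w\<in>X. \<rho> w i * h w)" for h
      using U outside assms(1) by (intro sum.mono_neutral_left) auto
    have card_U: "card ?U \<le> i + 1" using card_image_le[of "{..i}" g] by simp
    have "\<rho> w i = 0" if w: "w \<in> ?U" for w
    proof (rule generic_affinely_independent[OF assms(1,2) U card_U _ _ _ w])
      show "i \<le> d" using less.prems by simp
      show "(\<Sum>w\<in>?U. \<rho> w i) = 0" using to_U[of "\<lambda>_. 1"] translation[OF less.prems] by simp
      fix j assume j: "j < i"
      then have "(\<Sum>w\<in>X. \<rho> w j * x (w, i)) = 0" using less by (intro sum.neutral) auto
      then show "(\<Sum>w\<in>?U. \<rho> w i * x (w, j)) = 0"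
        using rotation[of i j] j less.prems to_U[of "\<lambda>w. x (w, j)"] by simp
    qed
    then show ?case using outside by blast
  qed
  then have "\<forall>b\<in>B. c b = 0"
    using assms(5) unfolding rows_independent_def \<rho>_def by (auto simp: mem_Times_iff)
  then show False using c(1) by blast
qed

section \<open>Fundamental stresses\<close>

definition fundamental_stress ::
  "nat \<Rightarrow> 'v set \<Rightarrow> ('v \<times> nat \<Rightarrow> complex) \<Rightarrow> 'v set set \<Rightarrow> 'v set \<Rightarrow> ('v set \<Rightarrow> complex) \<Rightarrow> bool" where
  "fundamental_stress d X x B e \<omega> \<longleftrightarrow>
     stress d X x \<omega> \<and> \<omega> e = 1 \<and> (\<forall>a. a \<notin> insert e B \<longrightarrow> \<omega> a = 0)"

lemma sum_over_pairs:
  assumes "finite X" "F \<subseteq> pairs X" "\<forall>a. a \<notin> F \<longrightarrow> \<omega> a = 0"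
  shows "(\<Sum>a\<in>pairs X. \<omega> a * R a) = (\<Sum>a\<in>F. \<omega> a * (R a :: complex))"
  using assms by (intro sum.mono_neutral_right) (auto simp: finite_pairs)

text \<open>Two stresses supported on \<open>insert e B\<close> with equal value at \<open>e\<close> differ by a dependence of the
  independent rows in \<open>B\<close>.\<close>

lemma stress_unique:
  assumes "finite X" "B \<subseteq> pairs X" "rows_independent d X (curry x) B"
    and "fundamental_stress d X x B e \<omega>"
    and "stress d X x \<psi>" "\<forall>a. a \<notin> insert e B \<longrightarrow> \<psi> a = 0" "e \<notin> B"
  shows "\<psi> a = \<psi> e * \<omega> a"
proof -
  define \<phi> where "\<phi> = (\<lambda>a. 1 * \<psi> a + (- \<psi> e) * \<omega> a)"
  have "stress d X x \<phi>"
    using assms(4,5) unfolding \<phi>_def fundamental_stress_def by (intro stress_combination) auto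
  moreover have out: "\<forall>a. a \<notin> B \<longrightarrow> \<phi> a = 0"
  proof (intro allI impI)
    fix a assume "a \<notin> B"
    then show "\<phi> a = 0"
      using assms(4,6) by (cases "a = e") (auto simp: \<phi>_def fundamental_stress_def)
  qed
  ultimately have "\<forall>y\<in>X \<times> {..<d}. (\<Sum>a\<in>B. \<phi> a * jacobian_row d (curry x) a y) = 0"
    unfolding stress_def sum_over_pairs[OF assms(1,2) out] by blast
  then have "\<forall>b\<in>B. \<phi> b = 0" using assms(3) by (auto simp: rows_independent_def)
  then have "\<phi> a = 0" using out by blast
  then show ?thesis by (simp add: \<phi>_def)
qed

lemma fundamental_stress_exists:
  assumes "finite X" "E \<subseteq> pairs X" "B \<subseteq> E" "rows_independent d X (curry x) B"
    and "\<And>B'. B' \<subseteq> E \<Longrightarrow> rows_independent d X (curry x) B' \<Longrightarrow> card B' \<le> card B"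
    and "e \<in> E - B"
  shows "\<exists>\<omega>. fundamental_stress d X x B e \<omega>"
proof -
  have finB: "finite B" using assms finite_pairs finite_subset by metis
  then have "card (insert e B) > card B" using assms(6) by simp
  then have "\<not> rows_independent d X (curry x) (insert e B)"
    using assms(5)[of "insert e B"] assms(3,6) by auto
  then obtain c where c: "\<forall>y\<in>X \<times> {..<d}. (\<Sum>a\<in>insert e B. c a * jacobian_row d (curry x) a y) = 0"
    "\<exists>a\<in>insert e B. c a \<noteq> 0"
    by (auto simp: rows_independent_def)
  have ce: "c e \<noteq> 0"
  proof
    assume "c e = 0"
    then have "\<forall>y\<in>X \<times> {..<d}. (\<Sum>a\<in>B. c a * jacobian_row d (curry x) a y) = 0"
      using c(1) finB assms(6) by simp
    then have "\<forall>b\<in>B. c b = 0" using assms(4) unfolding rows_independent_def by blast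
    then show False using c(2) \<open>c e = 0\<close> by auto
  qed
  define \<omega> where "\<omega> a = (if a \<in> insert e B then c a / c e else 0)" for a
  have out: "\<forall>a. a \<notin> insert e B \<longrightarrow> \<omega> a = 0" by (auto simp: \<omega>_def)
  have sub: "insert e B \<subseteq> pairs X" using assms by auto
  have "stress d X x \<omega>"
    unfolding stress_def sum_over_pairs[OF assms(1) sub out]
  proof
    fix y assume "y \<in> X \<times> {..<d}"
    have "(\<Sum>a\<in>insert e B. \<omega> a * jacobian_row d (curry x) a y) =
        (\<Sum>a\<in>insert e B. c a * jacobian_row d (curry x) a y) / c e"
      unfolding sum_divide_distrib by (intro sum.cong) (auto simp: \<omega>_def)
    then show "(\<Sum>a\<in>insert e B. \<omega> a * jacobian_row d (curry x) a y) = 0"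
      using c(1) \<open>y \<in> X \<times> {..<d}\<close> by (metis divide_eq_0_iff)
  qed
  then show ?thesis using ce out by (intro exI[of _ \<omega>]) (simp add: fundamental_stress_def \<omega>_def)
qed

text \<open>The fundamental stress at the generic point \<open>x\<close> comes from a family of stresses that is polynomial in
  the configuration \<open>z\<close>. The normalisation to value 1 at \<open>e\<close> is given up to avoid denominators. At each
  \<open>z\<close> the member of the family is a stress for all configurations \<open>q\<close> with the same lengths.\<close>

lemma universal_stress:
  assumes "finite X" "generic_point (X \<times> {..<d}) x"
    and "B \<subseteq> pairs X" "rows_independent d X (curry x) B" "e \<in> pairs X - B"
    and "fundamental_stress d X x B e \<omega>"
  shows "\<exists>\<Psi>. (\<forall>a. \<Psi> a \<in> rat_polys (X \<times> {..<d})) \<and> (\<forall>a z. a \<notin> insert e B \<longrightarrow> \<Psi> a z = 0) \<and>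
    \<Psi> e x \<noteq> 0 \<and> (\<forall>a. \<Psi> a x = \<Psi> e x * \<omega> a) \<and>
    (\<forall>z q. (\<forall>a\<in>insert e B. measurement d (curry q) a = measurement d (curry z) a) \<longrightarrow>
       stress d X q (\<lambda>a. \<Psi> a z))"
proof -
  let ?Y = "X \<times> {..<d}" and ?J = "\<lambda>a y z. jacobian_row d (curry z) a y"
  let ?f = "\<lambda>a x. measurement d (curry x) a"
  have sub: "insert e B \<subseteq> pairs X" using assms by auto
  have finY: "finite ?Y" and finB: "finite B"
    using assms(1,3) finite_pairs finite_subset by (blast intro: finite_cartesian_product)+
  have e: "e \<notin> B" using assms(5) by simp
  have \<omega>: "stress d X x \<omega>" "\<omega> e = 1" "\<forall>a. a \<notin> insert e B \<longrightarrow> \<omega> a = 0"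
    using assms(6) by (auto simp: fundamental_stress_def)
  have dep: "(\<Sum>b\<in>B. \<omega> b * ?J b y x) + ?J e y x = 0" if "y \<in> ?Y" for y
  proof -
    have "(\<Sum>a\<in>insert e B. \<omega> a * ?J a y x) = 0"
      using \<omega>(1) that unfolding stress_def sum_over_pairs[OF assms(1) sub \<omega>(3)] by blast
    then show ?thesis using finB e \<omega>(2) by (simp add: add.commute)
  qed
  have "\<exists>\<Psi>. (\<forall>a\<in>insert e B. \<Psi> a \<in> rat_polys ?Y) \<and> \<Psi> e x \<noteq> 0 \<and>
    (\<forall>z q. (\<forall>a\<in>insert e B. ?f a q = ?f a z) \<longrightarrow>
       (\<forall>y\<in>?Y. (\<Sum>a\<in>insert e B. \<Psi> a z * ?J a y q) = 0))"
  proof (rule universal_dependency[OF finY finB e assms(2), where w = \<omega>])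
    show "rat_poly ?Y 2 (?f a)" if "a \<in> insert e B" for a
      using sub that by (intro rat_poly_measurement) auto
    show "((\<lambda>t. ?f a (z(y := t))) has_field_derivative ?J a y z) (at (z y))"
      if "a \<in> insert e B" "y \<in> ?Y" for a y z
      using sub that by (intro measurement_derivative) auto
    show "\<forall>b\<in>B. c b = 0" if "\<forall>y\<in>?Y. (\<Sum>b\<in>B. c b * ?J b y x) = 0" for c
      using assms(4) that unfolding rows_independent_def by blast
  qed (rule dep)
  then obtain \<Psi> where \<Psi>: "\<And>a. a \<in> insert e B \<Longrightarrow> \<Psi> a \<in> rat_polys ?Y" "\<Psi> e x \<noteq> 0"
    "\<And>z q. \<forall>a\<in>insert e B. ?f a q = ?f a z \<Longrightarrow>
       \<forall>y\<in>?Y. (\<Sum>a\<in>insert e B. \<Psi> a z * ?J a y q) = 0" by blast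
  define \<Phi> where "\<Phi> a = (if a \<in> insert e B then \<Psi> a else (\<lambda>_. 0))" for a
  have out: "\<forall>a. a \<notin> insert e B \<longrightarrow> \<Phi> a z = 0" for z by (simp add: \<Phi>_def)
  have stress: "stress d X q (\<lambda>a. \<Phi> a z)" if "\<forall>a\<in>insert e B. ?f a q = ?f a z" for z q
  proof -
    have "(\<Sum>a\<in>insert e B. \<Phi> a z * R a) = (\<Sum>a\<in>insert e B. \<Psi> a z * R a)" for R
      by (intro sum.cong) (auto simp: \<Phi>_def)
    then show ?thesis
      using \<Psi>(3)[OF that] unfolding stress_def sum_over_pairs[OF assms(1) sub out] by simp
  qed
  have "\<Phi> a x = \<Phi> e x * \<omega> a" for a
    by (rule stress_unique[OF assms(1,3,4,6) _ out e]) (rule stress, simp)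
  moreover have "\<Phi> a \<in> rat_polys ?Y" for a using \<Psi>(1) by (simp add: \<Phi>_def rat_polys_zero)
  moreover have "\<Phi> e x \<noteq> 0" using \<Psi>(2) by (simp add: \<Phi>_def)
  ultimately show ?thesis using out stress by (intro exI[of _ \<Phi>]) blast
qed

section \<open>Edges whose length is determined by the other edges\<close>

lemma stress_matrix_scale:
  "(\<And>a. \<psi> a = c * \<omega> a) \<Longrightarrow> stress_matrix X \<psi> w v = c * stress_matrix X \<omega> w v"
  by (simp add: stress_matrix_def sum_distrib_left)

lemma stress_matrix_rat_polys:
  assumes "\<And>a. \<Psi> a \<in> rat_polys Y"
  shows "(\<lambda>z. stress_matrix X (\<lambda>a. \<Psi> a z) w v) \<in> rat_polys Y"
proof (cases "v = w")
  case True
  then show ?thesis unfolding stress_matrix_def if_P[OF True] by (intro rat_polys_sum assms)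
next
  case False
  then show ?thesis unfolding stress_matrix_def if_not_P[OF False] by (intro rat_polys_minus assms)
qed

text \<open>The condition that makes an edge superfluous: the stress matrix of its fundamental stress is spanned,
  row by row, by the stress matrices of other fundamental stresses. Every configuration that is in
  equilibrium with those is then in equilibrium with this one as well.\<close>

definition stress_redundant ::
  "nat \<Rightarrow> 'v set \<Rightarrow> ('v \<times> nat \<Rightarrow> complex) \<Rightarrow> 'v set set \<Rightarrow> 'v set \<Rightarrow> bool" where
  "stress_redundant d X x E e \<longleftrightarrow>
     (\<exists>B S \<omega>. B \<subseteq> E \<and> rows_independent d X (curry x) B \<and> e \<in> E - B \<and> finite S \<and> S \<subseteq> E - B - {e} \<and>
        (\<forall>j\<in>insert e S. fundamental_stress d X x B j (\<omega> j)) \<and>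
        (\<forall>w\<in>X. \<exists>M. \<forall>v\<in>X. stress_matrix X (\<omega> e) w v =
           (\<Sum>(j, u)\<in>S \<times> X. M j u * stress_matrix X (\<omega> j) u v)))"

text \<open>The hypothesis refers to one generic point \<open>x\<close>, the conclusion to any other generic point \<open>z\<close>. The
  spanning relations are carried over by \<open>polynomial_solution\<close>, the stresses by \<open>universal_stress\<close>. The
  stresses indexed by \<open>S\<close> do not involve \<open>e\<close>, so they are stresses of \<open>q\<close>; by the spanning relations so
  is the one of \<open>e\<close>, and Euler's identity determines the length of \<open>e\<close>.\<close>

lemma stress_redundant_imp_determined:
  assumes "finite X" "generic_point (X \<times> {..<d}) x" "E \<subseteq> pairs X"
    and "stress_redundant d X x E e"
    and "generic_point (X \<times> {..<d}) z"
    and same: "\<And>a. a \<in> E - {e} \<Longrightarrow> measurement d (curry q) a = measurement d (curry z) a"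
  shows "measurement d (curry q) e = measurement d (curry z) e"
proof -
  let ?Y = "X \<times> {..<d}" and ?L = "stress_matrix X"
  obtain B S \<omega> where B: "B \<subseteq> E" "rows_independent d X (curry x) B" "e \<in> E - B"
    and S: "finite S" "S \<subseteq> E - B - {e}"
    and \<omega>: "\<And>j. j \<in> insert e S \<Longrightarrow> fundamental_stress d X x B j (\<omega> j)"
    and span: "\<And>w. w \<in> X \<Longrightarrow> \<exists>M. \<forall>v\<in>X. ?L (\<omega> e) w v = (\<Sum>(j, u)\<in>S \<times> X. M j u * ?L (\<omega> j) u v)"
    using assms(4) unfolding stress_redundant_def by blast
  have finB: "finite B" using B(1) assms(1,3) finite_pairs finite_subset by metis
  define universal where "universal j \<Psi> \<longleftrightarrow>
    (\<forall>a. \<Psi> a \<in> rat_polys ?Y) \<and> (\<forall>a z. a \<notin> insert j B \<longrightarrow> \<Psi> a z = 0) \<and>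
    \<Psi> j x \<noteq> 0 \<and> (\<forall>a. \<Psi> a x = \<Psi> j x * \<omega> j a) \<and>
    (\<forall>z q. (\<forall>a\<in>insert j B. measurement d (curry q) a = measurement d (curry z) a) \<longrightarrow>
       stress d X q (\<lambda>a. \<Psi> a z))" for j and \<Psi> :: "'a set \<Rightarrow> ('a \<times> nat \<Rightarrow> complex) \<Rightarrow> complex"
  have "\<forall>j\<in>insert e S. \<exists>\<Psi>. universal j \<Psi>"
    unfolding universal_def
    using B S assms(3) \<omega> by (intro ballI universal_stress[OF assms(1,2)]) auto
  from bchoice[OF this] obtain \<Psi> where "\<forall>j\<in>insert e S. universal j (\<Psi> j)" ..
  then have \<Psi>:
    "\<And>j a. j \<in> insert e S \<Longrightarrow> \<Psi> j a \<in> rat_polys ?Y"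
    "\<And>j a z. j \<in> insert e S \<Longrightarrow> a \<notin> insert j B \<Longrightarrow> \<Psi> j a z = 0"
    "\<And>j. j \<in> insert e S \<Longrightarrow> \<Psi> j j x \<noteq> 0"
    "\<And>j a. j \<in> insert e S \<Longrightarrow> \<Psi> j a x = \<Psi> j j x * \<omega> j a"
    "\<And>j z q. j \<in> insert e S \<Longrightarrow>
       \<forall>a\<in>insert j B. measurement d (curry q) a = measurement d (curry z) a \<Longrightarrow>
       stress d X q (\<lambda>a. \<Psi> j a z)"
    unfolding universal_def by meson+
  have L_x: "?L (\<lambda>a. \<Psi> j a x) w v = \<Psi> j j x * ?L (\<omega> j) w v" if "j \<in> insert e S" for j w v
    by (rule stress_matrix_scale) (rule \<Psi>(4)[OF that])
  have "(\<Sum>v\<in>X. ?L (\<lambda>a. \<Psi> e a z) w v * q (v, i)) = 0" if w: "w \<in> X" and i: "i < d" for w i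
  proof -
    obtain M where M: "\<And>v. v \<in> X \<Longrightarrow> ?L (\<omega> e) w v = (\<Sum>(j, u)\<in>S \<times> X. M j u * ?L (\<omega> j) u v)"
      using span[OF w] by blast
    have sol: "(\<Sum>(j, u)\<in>S \<times> X. ?L (\<lambda>a. \<Psi> j a x) u v * (\<Psi> e e x * M j u / \<Psi> j j x)) =
        ?L (\<lambda>a. \<Psi> e a x) w v" if "v \<in> X" for v
    proof -
      have "?L (\<lambda>a. \<Psi> e a x) w v = (\<Sum>(j, u)\<in>S \<times> X. \<Psi> e e x * (M j u * ?L (\<omega> j) u v))"
        by (simp add: L_x M[OF that] sum_distrib_left case_prod_unfold)
      also have "\<dots> = (\<Sum>(j, u)\<in>S \<times> X. ?L (\<lambda>a. \<Psi> j a x) u v * (\<Psi> e e x * M j u / \<Psi> j j x))"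
        using \<Psi>(3) by (intro sum.cong) (auto simp: L_x)
      finally show ?thesis by simp
    qed
    have "\<exists>\<delta> T. \<delta> \<in> rat_polys ?Y \<and> \<delta> x \<noteq> 0 \<and> (\<forall>c\<in>S \<times> X. T c \<in> rat_polys ?Y) \<and>
      (\<forall>v\<in>X. \<forall>z. (\<Sum>c\<in>S \<times> X. ?L (\<lambda>a. \<Psi> (fst c) a z) (snd c) v * T c z) =
         \<delta> z * ?L (\<lambda>a. \<Psi> e a z) w v)"
    proof (rule polynomial_solution[OF _ assms(2),
          where s = "\<lambda>c. \<Psi> e e x * M (fst c) (snd c) / \<Psi> (fst c) (fst c) x"])
      show "finite (S \<times> X)" using S(1) assms(1) by simp
      show "(\<lambda>z. ?L (\<lambda>a. \<Psi> (fst c) a z) (snd c) v) \<in> rat_polys ?Y" if "c \<in> S \<times> X" for v c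
        using that \<Psi>(1) by (intro stress_matrix_rat_polys) auto
      show "(\<lambda>z. ?L (\<lambda>a. \<Psi> e a z) w v) \<in> rat_polys ?Y" for v
        using \<Psi>(1) by (intro stress_matrix_rat_polys) auto
      show "(\<Sum>c\<in>S \<times> X. ?L (\<lambda>a. \<Psi> (fst c) a x) (snd c) v *
          (\<Psi> e e x * M (fst c) (snd c) / \<Psi> (fst c) (fst c) x)) = ?L (\<lambda>a. \<Psi> e a x) w v"
        if "v \<in> X" for v
        using sol[OF that] by (simp add: case_prod_unfold)
    qed
    then obtain \<delta> T where T: "\<delta> \<in> rat_polys ?Y" "\<delta> x \<noteq> 0"
      "\<And>v. v \<in> X \<Longrightarrow> (\<Sum>c\<in>S \<times> X. ?L (\<lambda>a. \<Psi> (fst c) a z) (snd c) v * T c z) =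
         \<delta> z * ?L (\<lambda>a. \<Psi> e a z) w v" by blast
    have "\<delta> z \<noteq> 0" using generic_pointD[OF assms(5) T(1), of x] T(2) by blast
    moreover have "\<delta> z * (\<Sum>v\<in>X. ?L (\<lambda>a. \<Psi> e a z) w v * q (v, i)) = 0"
    proof -
      have "\<delta> z * (\<Sum>v\<in>X. ?L (\<lambda>a. \<Psi> e a z) w v * q (v, i)) =
          (\<Sum>v\<in>X. (\<Sum>c\<in>S \<times> X. ?L (\<lambda>a. \<Psi> (fst c) a z) (snd c) v * T c z) * q (v, i))"
        by (simp add: T(3) sum_distrib_left mult.assoc)
      also have "\<dots> = (\<Sum>c\<in>S \<times> X. T c z * (\<Sum>v\<in>X. ?L (\<lambda>a. \<Psi> (fst c) a z) (snd c) v * q (v, i)))"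
        unfolding sum_distrib_left sum_distrib_right by (subst sum.swap) (simp add: mult_ac)
      also have "\<dots> = 0"
      proof (intro sum.neutral ballI)
        fix c assume c: "c \<in> S \<times> X"
        then have "fst c \<in> S" by auto
        then have "stress d X q (\<lambda>a. \<Psi> (fst c) a z)"
          using B S same by (intro \<Psi>(5)) auto
        then have "(\<Sum>v\<in>X. ?L (\<lambda>a. \<Psi> (fst c) a z) (snd c) v * q (v, i)) = 0"
          using c i unfolding stress_iff_stress_matrix[OF assms(1)] by auto
        then show "T c z * (\<Sum>v\<in>X. ?L (\<lambda>a. \<Psi> (fst c) a z) (snd c) v * q (v, i)) = 0" by simp
      qed
      finally show ?thesis .
    qed
    ultimately show ?thesis by simp
  qed
  then have stress_q: "stress d X q (\<lambda>a. \<Psi> e a z)"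
    unfolding stress_iff_stress_matrix[OF assms(1)] by blast
  have stress_z: "stress d X z (\<lambda>a. \<Psi> e a z)" by (intro \<Psi>(5)) auto
  have sum: "(\<Sum>a\<in>pairs X. \<Psi> e a z * R a) = \<Psi> e e z * R e + (\<Sum>a\<in>B. \<Psi> e a z * R a)" for R
  proof -
    have "insert e B \<subseteq> pairs X" using B assms(3) by blast
    moreover have "\<forall>a. a \<notin> insert e B \<longrightarrow> \<Psi> e a z = 0" using \<Psi>(2) by blast
    ultimately have "(\<Sum>a\<in>pairs X. \<Psi> e a z * R a) = (\<Sum>a\<in>insert e B. \<Psi> e a z * R a)"
      by (rule sum_over_pairs[OF assms(1)])
    then show ?thesis using B finB by simp
  qed
  have "\<Psi> e e z * measurement d (curry q) e + (\<Sum>a\<in>B. \<Psi> e a z * measurement d (curry q) a)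
      = \<Psi> e e z * measurement d (curry z) e + (\<Sum>a\<in>B. \<Psi> e a z * measurement d (curry z) a)"
    using stress_euler[OF assms(1) stress_q] stress_euler[OF assms(1) stress_z] by (simp add: sum)
  moreover have "(\<Sum>a\<in>B. \<Psi> e a z * measurement d (curry q) a) =
      (\<Sum>a\<in>B. \<Psi> e a z * measurement d (curry z) a)"
    using B same by (intro sum.cong) auto
  moreover have "\<Psi> e e z \<noteq> 0"
    using generic_pointD[OF assms(5) \<Psi>(1)[of e e], of x] \<Psi>(3)[of e] by auto
  ultimately show ?thesis by simp
qed

section \<open>Graphs without redundant edges\<close>

locale irredundant_framework =
  fixes d :: nat and X :: "'v set" and x :: "'v \<times> nat \<Rightarrow> complex" and E :: "'v set set"
  assumes finite_X: "finite X" and generic_x: "generic_point (X \<times> {..<d}) x"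
    and E_pairs: "E \<subseteq> pairs X" and card_X: "d + 1 \<le> card X"
    and irredundant: "e \<in> E \<Longrightarrow> \<not> stress_redundant d X x E e"
begin

abbreviation L :: "('v set \<Rightarrow> complex) \<Rightarrow> 'v \<Rightarrow> 'v \<Rightarrow> complex" where
  "L \<equiv> stress_matrix X"

text \<open>A choice of fundamental stresses with respect to \<open>B\<close>. They exist if \<open>B\<close> is a basis.\<close>

definition frame :: "'v set set \<Rightarrow> ('v set \<Rightarrow> 'v set \<Rightarrow> complex) \<Rightarrow> bool" where
  "frame B \<omega> \<longleftrightarrow> B \<subseteq> E \<and> rows_independent d X (curry x) B \<and>
     (\<forall>j\<in>E - B. fundamental_stress d X x B j (\<omega> j))"

lemma finite_E: "finite E"
  using E_pairs finite_X finite_pairs finite_subset by metis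

lemma row_affine_dependence:
  "frame B \<omega> \<Longrightarrow> j \<in> E - B \<Longrightarrow> w \<in> X \<Longrightarrow> affine_dependence d X x (L (\<omega> j) w)"
  by (rule stress_matrix_row_affine_dependence[OF finite_X])
     (auto simp: frame_def fundamental_stress_def)

text \<open>The row \<open>w\<close> of the stress matrix of \<open>j\<close> is not spanned by the rows of the other fundamental stresses.\<close>

definition outside_row ::
  "'v set set \<Rightarrow> ('v set \<Rightarrow> 'v set \<Rightarrow> complex) \<Rightarrow> 'v set \<Rightarrow> 'v \<Rightarrow> bool" where
  "outside_row B \<omega> j w \<longleftrightarrow> w \<in> X \<and>
     (\<forall>M. \<exists>v\<in>X. L (\<omega> j) w v \<noteq> (\<Sum>(i, u)\<in>(E - B - {j}) \<times> X. M i u * L (\<omega> i) u v))"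

lemma outside_row_exists:
  assumes "frame B \<omega>" "j \<in> E - B"
  shows "\<exists>w. outside_row B \<omega> j w"
proof (rule ccontr)
  assume none: "\<not> ?thesis"
  have "\<exists>M. \<forall>v\<in>X. L (\<omega> j) w v = (\<Sum>(i, u)\<in>(E - B - {j}) \<times> X. M i u * L (\<omega> i) u v)" if "w \<in> X" for w
    using none that by (simp add: outside_row_def)
  moreover have "finite (E - B - {j})" using finite_E by simp
  moreover have "\<forall>i\<in>insert j (E - B - {j}). fundamental_stress d X x B i (\<omega> i)"
    using assms by (auto simp: frame_def)
  ultimately have "stress_redundant d X x E j"
    using assms unfolding stress_redundant_def frame_def
    by (intro exI[of _ B] exI[of _ "E - B - {j}"] exI[of _ \<omega>]) blast
  then show False using irredundant assms(2) by blast
qed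

text \<open>The linear relation is between the rows \<open>g k\<close> of the stress matrices of \<open>f k\<close>. Solving it for the
  outside row would express that row through rows of other fundamental stresses, unless its
  coefficient vanishes. Several \<open>k\<close> may refer to the same row, hence the grouping in the proof.\<close>

lemma outside_row_coefficient:
  assumes "outside_row B \<omega> (f r) (g r)"
    and "finite K" "r \<in> K" "\<And>k. k \<in> K \<Longrightarrow> f k \<in> E - B" "\<And>k. k \<in> K \<Longrightarrow> g k \<in> X"
    and "\<And>k. k \<in> K \<Longrightarrow> k \<noteq> r \<Longrightarrow> f k \<noteq> f r"
    and zero: "\<And>v. v \<in> X \<Longrightarrow> (\<Sum>k\<in>K. c k * L (\<omega> (f k)) (g k) v) = 0"
  shows "c r = 0"
proof (rule ccontr)
  assume c0: "c r \<noteq> 0"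
  define K' where "K' = K - {r}"
  define T where "T = (E - B - {f r}) \<times> X"
  define M where "M i u = (\<Sum>k\<in>{k\<in>K'. (f k, g k) = (i, u)}. - (c k / c r))" for i u
  have "L (\<omega> (f r)) (g r) v = (\<Sum>(i, u)\<in>T. M i u * L (\<omega> i) u v)" if v: "v \<in> X" for v
  proof -
    have "c r * L (\<omega> (f r)) (g r) v + (\<Sum>k\<in>K'. c k * L (\<omega> (f k)) (g k) v) = 0"
      using zero[OF v] assms(2,3) by (simp add: K'_def sum.remove)
    then have "L (\<omega> (f r)) (g r) v = - (\<Sum>k\<in>K'. c k * L (\<omega> (f k)) (g k) v) / c r"
      using c0 by (simp add: field_simps add_eq_0_iff)
    also have "\<dots> = (\<Sum>k\<in>K'. - (c k / c r) * L (\<omega> (f k)) (g k) v)"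
      by (simp add: sum_negf sum_divide_distrib)
    also have "\<dots> = (\<Sum>t\<in>T. \<Sum>k\<in>{k\<in>K'. (f k, g k) = t}. - (c k / c r) * L (\<omega> (f k)) (g k) v)"
      using assms(2-6) finite_E finite_X
      by (intro sum.group[symmetric]) (auto simp: K'_def T_def)
    also have "\<dots> = (\<Sum>(i, u)\<in>T. M i u * L (\<omega> i) u v)"
      by (intro sum.cong) (auto simp: M_def sum_distrib_right intro!: sum.cong)
    finally show ?thesis .
  qed
  then show False using assms(1) unfolding outside_row_def T_def by blast
qed

text \<open>One outside row is chosen for each fundamental stress. If there were too many, these affine
  dependences would be linearly dependent.\<close>

lemma nonbasis_bound:
  assumes "frame B \<omega>"
  shows "card (E - B) + d + 1 \<le> card X"
proof (rule ccontr)
  assume contra: "\<not> ?thesis"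
  obtain g where g: "\<And>j. j \<in> E - B \<Longrightarrow> outside_row B \<omega> j (g j)"
    using outside_row_exists[OF assms] by metis
  then have gX: "g j \<in> X" if "j \<in> E - B" for j using that by (auto simp: outside_row_def)
  have "finite (E - B)" using finite_E by simp
  then have "\<exists>c. (\<exists>j\<in>E - B. c j \<noteq> 0) \<and> (\<forall>u\<in>X. (\<Sum>j\<in>E - B. c j * L (\<omega> j) (g j) u) = 0)"
    using contra row_affine_dependence[OF assms] gX
    by (intro affine_dependences_linearly_dependent[OF finite_X generic_x card_X]) auto
  then obtain c where c: "\<exists>j\<in>E - B. c j \<noteq> 0"
    "\<And>v. v \<in> X \<Longrightarrow> (\<Sum>j\<in>E - B. c j * L (\<omega> j) (g j) v) = 0"
    by blast
  have "c j = 0" if "j \<in> E - B" for j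
    using that g gX finite_E c(2)
    by (intro outside_row_coefficient[where f = id and g = g and K = "E - B" and r = j]) auto
  then show False using c(1) by blast
qed

text \<open>In the case of equality, the rows \<open>w\<close> and \<open>w'\<close> of the matrix of \<open>j\<close> and one outside row of each other
  fundamental stress are one affine dependence too many. The outside rows have coefficient zero in
  the resulting linear relation, so the rows \<open>w\<close> and \<open>w'\<close> are proportional.\<close>

lemma stress_matrix_minors:
  assumes "frame B \<omega>" "card (E - B) + d + 1 = card X" "j \<in> E - B"
    and "w \<in> X" "w' \<in> X" "v \<in> X" "v' \<in> X"
  shows "L (\<omega> j) w v * L (\<omega> j) w' v' = L (\<omega> j) w v' * L (\<omega> j) w' v"
proof -
  obtain h where h: "\<And>j. j \<in> E - B \<Longrightarrow> outside_row B \<omega> j (h j)"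
    using outside_row_exists[OF assms(1)] by metis
  define K where "K = insert None (Some ` (E - B))"
  define f where "f = case_option j (\<lambda>i. i)"
  define g where "g = case_option w' (\<lambda>i. if i = j then w else h i)"
  have finK: "finite K" using finite_E by (simp add: K_def)
  have f: "f k \<in> E - B" if "k \<in> K" for k using that assms(3) by (auto simp: K_def f_def)
  have g: "g k \<in> X" if "k \<in> K" for k
    using that assms(4,5) h by (auto simp: K_def g_def outside_row_def)
  have "card K = card (E - B) + 1"
    using finite_E by (simp add: K_def card_image)
  then have "card X < card K + d + 1" using assms(2) by simp
  then have "\<exists>c. (\<exists>k\<in>K. c k \<noteq> 0) \<and> (\<forall>u\<in>X. (\<Sum>k\<in>K. c k * L (\<omega> (f k)) (g k) u) = 0)"
    using row_affine_dependence[OF assms(1)] f g finK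
    by (intro affine_dependences_linearly_dependent[OF finite_X generic_x card_X]) auto
  then obtain c where c: "\<exists>k\<in>K. c k \<noteq> 0"
    "\<And>v. v \<in> X \<Longrightarrow> (\<Sum>k\<in>K. c k * L (\<omega> (f k)) (g k) v) = 0"
    by blast
  have other: "c (Some i) = 0" if "i \<in> E - B" "i \<noteq> j" for i
  proof (rule outside_row_coefficient[where K = K and f = f and g = g, OF _ finK _ f g _ c(2)])
    show "outside_row B \<omega> (f (Some i)) (g (Some i))" using h that by (simp add: f_def g_def)
    show "Some i \<in> K" using that by (simp add: K_def)
    show "f k \<noteq> f (Some i)" if "k \<in> K" "k \<noteq> Some i" for k
      using that \<open>i \<noteq> j\<close> by (auto simp: K_def f_def)
  qed
  have pair: "c None * L (\<omega> j) w' v + c (Some j) * L (\<omega> j) w v = 0" if "v \<in> X" for v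
  proof -
    have "(\<Sum>k\<in>K. c k * L (\<omega> (f k)) (g k) v) = (\<Sum>k\<in>{None, Some j}. c k * L (\<omega> (f k)) (g k) v)"
      using finK assms(3) other by (intro sum.mono_neutral_right) (auto simp: K_def)
    then show ?thesis using c(2)[OF that] by (simp add: f_def g_def)
  qed
  have "c None \<noteq> 0 \<or> c (Some j) \<noteq> 0"
    using c(1) other by (auto simp: K_def)
  then show ?thesis
  proof
    assume c0: "c None \<noteq> 0"
    then have "L (\<omega> j) w' v = - (c (Some j) / c None) * L (\<omega> j) w v" if "v \<in> X" for v
      using pair[OF that] by (simp add: field_simps add_eq_0_iff)
    then show ?thesis using assms by simp
  next
    assume c0: "c (Some j) \<noteq> 0"
    then have "L (\<omega> j) w v = - (c None / c (Some j)) * L (\<omega> j) w' v" if "v \<in> X" for v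
      using pair[OF that] by (simp add: field_simps add_eq_0_iff)
    then show ?thesis using assms by simp
  qed
qed

lemma fundamental_stress_entry:
  assumes "frame B \<omega>" "j \<in> E - B" "a \<noteq> b"
  shows "L (\<omega> j) a b = - \<omega> j {a, b}"
  using assms by (auto simp: stress_matrix_def)

text \<open>With \<open>j = {a, b}\<close> the entry at \<open>(a, b)\<close> is \<open>-1\<close>, so by the vanishing minors every entry is determined by
  the row \<open>a\<close>; symmetry of the matrix gives the form \<open>\<kappa> l l\<^sup>T\<close> with \<open>l\<close> the row \<open>a\<close>.\<close>

lemma stress_matrix_rank_one:
  assumes "frame B \<omega>" "card (E - B) + d + 1 = card X" "j \<in> E - B"
  shows "\<exists>\<kappa> l. \<kappa> \<noteq> 0 \<and> (\<forall>w\<in>X. \<forall>v\<in>X. L (\<omega> j) w v = \<kappa> * l w * l v) \<and>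
           affine_dependence d X x l \<and> (\<forall>u\<in>j. l u \<noteq> 0)"
proof -
  have "j \<in> pairs X" using assms(3) E_pairs by blast
  then obtain a b where ab: "a \<in> X" "b \<in> X" "a \<noteq> b" "j = {a, b}" by (rule pairsE)
  have "\<omega> j j = 1" using assms(1,3) by (auto simp: frame_def fundamental_stress_def)
  then have entry: "L (\<omega> j) a b = -1"
    using fundamental_stress_entry[OF assms(1,3) ab(3)] ab(4) by simp
  have row: "L (\<omega> j) w v = - L (\<omega> j) w b * L (\<omega> j) a v" if "w \<in> X" "v \<in> X" for w v
  proof -
    have "L (\<omega> j) w v = - (L (\<omega> j) w v * L (\<omega> j) a b)" using entry by simp
    also have "\<dots> = - (L (\<omega> j) w b * L (\<omega> j) a v)"
      by (simp only: stress_matrix_minors[OF assms that(1) ab(1) that(2) ab(2)])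
    finally show ?thesis by simp
  qed
  have col: "L (\<omega> j) w b = - L (\<omega> j) b b * L (\<omega> j) a w" if "w \<in> X" for w
    using row[OF ab(2) that] by (metis stress_matrix_sym)
  have eq: "L (\<omega> j) w v = L (\<omega> j) b b * L (\<omega> j) a w * L (\<omega> j) a v" if "w \<in> X" "v \<in> X" for w v
    using row[OF that] col[OF that(1)] by simp
  have "L (\<omega> j) b b * L (\<omega> j) a a * L (\<omega> j) a b \<noteq> 0"
    using eq[OF ab(1,2)] entry by simp
  then have nz: "L (\<omega> j) b b \<noteq> 0" "L (\<omega> j) a a \<noteq> 0" by auto
  show ?thesis
  proof (intro exI[of _ "L (\<omega> j) b b"] exI[of _ "L (\<omega> j) a"] conjI ballI)
    show "L (\<omega> j) a u \<noteq> 0" if "u \<in> j" for u using that ab(4) nz(2) entry by auto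
  qed (rule nz(1) eq row_affine_dependence[OF assms(1,3) ab(1)]; assumption?)+
qed

text \<open>All entries of \<open>\<kappa> l l\<^sup>T\<close> within the support of \<open>l\<close> are non-zero, and this support has at least \<open>d + 2\<close>
  elements because \<open>l\<close> is an affine dependence.\<close>

lemma stress_support_clique:
  assumes "frame B \<omega>" "card (E - B) + d + 1 = card X" "j \<in> E - B"
  shows "\<exists>U\<subseteq>X. d + 2 \<le> card U \<and> pairs U \<subseteq> {a \<in> E. \<omega> j a \<noteq> 0}"
proof -
  obtain \<kappa> l where l: "\<kappa> \<noteq> 0" "\<And>w v. w \<in> X \<Longrightarrow> v \<in> X \<Longrightarrow> L (\<omega> j) w v = \<kappa> * l w * l v"
    "affine_dependence d X x l" "\<forall>u\<in>j. l u \<noteq> 0"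
    using stress_matrix_rank_one[OF assms] by blast
  have "j \<in> pairs X" using assms(3) E_pairs by blast
  then obtain u where "u \<in> X" "u \<in> j" by (rule pairsE) auto
  with l(4) have "u \<in> X" "l u \<noteq> 0" by auto
  then have "d + 2 \<le> card {v \<in> X. l v \<noteq> 0}"
    by (rule affine_dependence_support[OF finite_X generic_x l(3)])
  moreover have "pairs {v \<in> X. l v \<noteq> 0} \<subseteq> {a \<in> E. \<omega> j a \<noteq> 0}"
  proof
    fix a assume "a \<in> pairs {v \<in> X. l v \<noteq> 0}"
    then obtain u v where uv: "u \<in> X" "v \<in> X" "l u \<noteq> 0" "l v \<noteq> 0" "u \<noteq> v" "a = {u, v}"
      by (auto elim!: pairsE)
    have "\<omega> j a = - (\<kappa> * l u * l v)"
      using fundamental_stress_entry[OF assms(1,3) uv(5)] l(2)[OF uv(1,2)] uv(6) by simp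
    then have "\<omega> j a \<noteq> 0" using l(1) uv by simp
    moreover from this have "a \<in> insert j B"
      using assms(1,3) unfolding frame_def fundamental_stress_def by blast
    ultimately show "a \<in> {a \<in> E. \<omega> j a \<noteq> 0}" using assms(1,3) by (auto simp: frame_def)
  qed
  ultimately show ?thesis by (intro exI[of _ "{v \<in> X. l v \<noteq> 0}"]) auto
qed

text \<open>Basis exchange: \<open>i\<close> enters and \<open>g\<close> leaves. The new fundamental stresses arise by clearing the value at
  \<open>g\<close> with a multiple of \<open>\<omega> i\<close>. Both cases are written as combinations of two stresses.\<close>

lemma frame_exchange:
  assumes "frame B \<omega>" "i \<in> E - B" "g \<in> B" "\<omega> i g \<noteq> 0"
  defines "\<omega>' \<equiv> \<lambda>h. if h = g then (\<lambda>a. 1 / \<omega> i g * \<omega> i a + 0 * \<omega> i a)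
                    else (\<lambda>a. 1 * \<omega> h a + (- (\<omega> h g / \<omega> i g)) * \<omega> i a)"
  shows "frame (insert i (B - {g})) \<omega>'"
proof -
  let ?B' = "insert i (B - {g})"
  have B: "B \<subseteq> E" "rows_independent d X (curry x) B"
    and fund: "\<And>j. j \<in> E - B \<Longrightarrow> fundamental_stress d X x B j (\<omega> j)"
    using assms(1) by (auto simp: frame_def)
  have sub: "B \<subseteq> pairs X" "?B' \<subseteq> pairs X" "?B' \<subseteq> E" using B(1) E_pairs assms(2) by auto
  have i: "i \<notin> B" "i \<noteq> g" using assms(2,3) by auto
  have stress: "stress d X x (\<omega> j)" and one: "\<omega> j j = 1"
    and out: "\<And>a. a \<notin> insert j B \<Longrightarrow> \<omega> j a = 0" if "j \<in> E - B" for j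
    using fund[OF that] by (auto simp: fundamental_stress_def)
  have "rows_independent d X (curry x) ?B'"
    unfolding rows_independent_def
  proof (intro allI impI)
    fix c assume c: "\<forall>y\<in>X \<times> {..<d}. (\<Sum>a\<in>?B'. c a * jacobian_row d (curry x) a y) = 0"
    define \<psi> where "\<psi> a = (if a \<in> ?B' then c a else 0)" for a
    have \<psi>_out: "\<forall>a. a \<notin> ?B' \<longrightarrow> \<psi> a = 0" by (simp add: \<psi>_def)
    have "(\<Sum>a\<in>?B'. \<psi> a * R a) = (\<Sum>a\<in>?B'. c a * R a)" for R
      by (intro sum.cong) (auto simp: \<psi>_def)
    then have "stress d X x \<psi>"
      using c unfolding stress_def sum_over_pairs[OF finite_X sub(2) \<psi>_out] by simp
    moreover have "\<forall>a. a \<notin> insert i B \<longrightarrow> \<psi> a = 0" using \<psi>_out by blast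
    ultimately have \<psi>: "\<psi> a = \<psi> i * \<omega> i a" for a
      by (rule stress_unique[OF finite_X sub(1) B(2) fund[OF assms(2)] _ _ i(1)])
    have "\<psi> g = 0" using i(2) by (simp add: \<psi>_def)
    then have "\<psi> i = 0" using \<psi>[of g] assms(4) by simp
    then have "\<psi> a = 0" for a using \<psi>[of a] by simp
    then show "\<forall>a\<in>?B'. c a = 0" by (metis \<psi>_def)
  qed
  moreover have "fundamental_stress d X x ?B' h (\<omega>' h)" if h: "h \<in> E - ?B'" for h
  proof (cases "h = g")
    case True
    have "stress d X x (\<omega>' h)"
      unfolding \<omega>'_def if_P[OF True] by (intro stress_combination stress[OF assms(2)])
    moreover have "\<omega>' h h = 1" using True assms(4) by (simp add: \<omega>'_def)
    moreover have "\<omega>' h a = 0" if "a \<notin> insert h ?B'" for a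
      using that True out[OF assms(2), of a] by (auto simp: \<omega>'_def)
    ultimately show ?thesis by (simp add: fundamental_stress_def)
  next
    case False
    then have hJ: "h \<in> E - B" "h \<noteq> i" using h by auto
    have "stress d X x (\<omega>' h)"
      unfolding \<omega>'_def if_not_P[OF False]
      by (intro stress_combination stress[OF assms(2)] stress[OF hJ(1)])
    moreover have "\<omega>' h h = 1"
      using False one[OF hJ(1)] out[OF assms(2), of h] hJ by (simp add: \<omega>'_def)
    moreover have "\<omega>' h a = 0" if "a \<notin> insert h ?B'" for a
    proof (cases "a = g")
      case True
      then show ?thesis using False assms(4) by (simp add: \<omega>'_def)
    next
      case False
      then show ?thesis
        using that \<open>h \<noteq> g\<close> out[OF assms(2), of a] out[OF hJ(1), of a] by (simp add: \<omega>'_def)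
    qed
    ultimately show ?thesis by (simp add: fundamental_stress_def)
  qed
  ultimately show ?thesis using sub(3) by (simp add: frame_def)
qed

text \<open>If \<open>g\<close> is in both supports, it lies in \<open>B\<close> and can be exchanged for \<open>i\<close>. The new fundamental stress of \<open>j\<close>
  has the matrix \<open>\<kappa> l l\<^sup>T - c \<mu> m m\<^sup>T\<close> with \<open>c \<noteq> 0\<close>. Its principal \<open>2 \<times> 2\<close> minors, which vanish, are multiples
  of the squares of the minors of \<open>(l, m)\<close>. So \<open>l\<close> and \<open>m\<close> are proportional; but \<open>\<omega> j\<close> vanishes at \<open>i\<close>, where
  \<open>\<omega> i\<close> does not.\<close>

lemma stress_supports_disjoint:
  assumes "frame B \<omega>" "card (E - B) + d + 1 = card X" "i \<in> E - B" "j \<in> E - B" "i \<noteq> j"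
  shows "\<omega> i g = 0 \<or> \<omega> j g = 0"
proof (rule ccontr)
  assume "\<not> ?thesis"
  then have g: "\<omega> i g \<noteq> 0" "\<omega> j g \<noteq> 0" by auto
  have out: "\<omega> h a = 0" if "h \<in> E - B" "a \<notin> insert h B" for h a
    using that assms(1) unfolding frame_def fundamental_stress_def by blast
  have gB: "g \<in> B" using out[OF assms(3), of g] out[OF assms(4), of g] g assms(3-5) by auto
  let ?B' = "insert i (B - {g})"
  define c where "c = \<omega> j g / \<omega> i g"
  define \<omega>' where "\<omega>' = (\<lambda>h. if h = g then (\<lambda>a. 1 / \<omega> i g * \<omega> i a + 0 * \<omega> i a)
                    else (\<lambda>a. 1 * \<omega> h a + (- (\<omega> h g / \<omega> i g)) * \<omega> i a))"
  have frame': "frame ?B' \<omega>'"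
    unfolding \<omega>'_def by (rule frame_exchange[OF assms(1,3) gB g(1)])
  have "E - ?B' = insert g (E - B - {i})" using gB assms(1,3) by (auto simp: frame_def)
  moreover have "card (insert g (E - B - {i})) = card (E - B)"
  proof -
    have "card (insert g (E - B - {i})) = Suc (card (E - B - {i}))" using finite_E gB by simp
    also have "\<dots> = card (E - B)" using finite_E assms(3) by (intro card_Suc_Diff1) auto
    finally show ?thesis .
  qed
  ultimately have card': "card (E - ?B') + d + 1 = card X" using assms(2) by simp
  have j': "j \<in> E - ?B'" "j \<noteq> g" using assms(4,5) gB by auto
  obtain \<kappa> l where l: "\<kappa> \<noteq> 0" "\<And>w v. w \<in> X \<Longrightarrow> v \<in> X \<Longrightarrow> L (\<omega> j) w v = \<kappa> * l w * l v"
    "\<forall>u\<in>j. l u \<noteq> 0"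
    using stress_matrix_rank_one[OF assms(1,2,4)] by blast
  obtain \<mu> m where m: "\<mu> \<noteq> 0" "\<And>w v. w \<in> X \<Longrightarrow> v \<in> X \<Longrightarrow> L (\<omega> i) w v = \<mu> * m w * m v"
    "\<forall>u\<in>i. m u \<noteq> 0"
    using stress_matrix_rank_one[OF assms(1-3)] by blast
  have L': "L (\<omega>' j) w v = \<kappa> * l w * l v - c * (\<mu> * m w * m v)" if "w \<in> X" "v \<in> X" for w v
  proof -
    have "L (\<omega>' j) w v = L (\<omega> j) w v - c * L (\<omega> i) w v"
      using j'(2) by (simp add: \<omega>'_def stress_matrix_def c_def sum_subtractf sum_distrib_left
          sum_divide_distrib algebra_simps)
    then show ?thesis using l(2) m(2) that by simp
  qed
  have proportional: "l u * m v = l v * m u" if "u \<in> X" "v \<in> X" for u v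
  proof -
    have "L (\<omega>' j) u u * L (\<omega>' j) v v - L (\<omega>' j) u v * L (\<omega>' j) v u = 0"
      using stress_matrix_minors[OF frame' card' j'(1) that that] by simp
    then have "c * \<kappa> * \<mu> * (l u * m v - l v * m u)\<^sup>2 = 0"
      using that by (simp add: L' power2_eq_square algebra_simps)
    then show ?thesis using g l(1) m(1) by (simp add: c_def)
  qed
  have "i \<in> pairs X" "j \<in> pairs X" using assms(3,4) E_pairs by auto
  then obtain a b where ab: "a \<in> X" "b \<in> X" "a \<noteq> b" "i = {a, b}" by (elim pairsE)
  have "\<omega> j i = 0" using out[OF assms(4), of i] assms(3,5) by auto
  then have "\<kappa> * l a * l b = 0"
    using fundamental_stress_entry[OF assms(1,4) ab(3)] l(2)[OF ab(1,2)] ab(4) by simp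
  then have "l a = 0 \<or> l b = 0" using l(1) by simp
  moreover have "m a \<noteq> 0" "m b \<noteq> 0" using m(3) ab(4) by auto
  ultimately have "l u = 0" if "u \<in> X" for u
    using proportional[OF that ab(1)] proportional[OF that ab(2)] by auto
  moreover obtain u where "u \<in> j" "u \<in> X" using \<open>j \<in> pairs X\<close> by (rule pairsE) auto
  ultimately show False using l(3) by blast
qed

text \<open>Put \<open>k = card (E - B)\<close> and \<open>c = (d + 1 choose 2)\<close>. The \<open>k\<close> disjoint cliques have at least \<open>c + d + 1\<close> edges
  each, so \<open>k (c + d + 1) \<le> card B + k\<close>. With \<open>card X = k + d + 1\<close> the rank bound reads
  \<open>card B \<le> d k + c\<close>, because \<open>d (d + 1) = 2 c\<close>. Together these give \<open>k c \<le> c\<close>, that is \<open>k \<le> 1\<close>.\<close>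

lemma equality_imp_complete:
  assumes "frame B \<omega>" "card (E - B) + d + 1 = card X"
    and "d > 0" "d + 2 \<le> card X" "card B + ((d + 1) choose 2) \<le> d * card X"
  shows "card X = d + 2 \<and> E = pairs X"
proof -
  let ?J = "E - B" and ?c = "(d + 1) choose 2"
  have "\<forall>j\<in>?J. \<exists>U. U \<subseteq> X \<and> d + 2 \<le> card U \<and> pairs U \<subseteq> {a \<in> E. \<omega> j a \<noteq> 0}"
    using stress_support_clique[OF assms(1,2)] by blast
  from bchoice[OF this] obtain U where
    "\<forall>j\<in>?J. U j \<subseteq> X \<and> d + 2 \<le> card (U j) \<and> pairs (U j) \<subseteq> {a \<in> E. \<omega> j a \<noteq> 0}" ..
  then have U: "U j \<subseteq> X" "d + 2 \<le> card (U j)" "pairs (U j) \<subseteq> {a \<in> E. \<omega> j a \<noteq> 0}"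
    if "j \<in> ?J" for j using that by auto
  have finJ: "finite ?J" using finite_E by simp
  have finU: "finite (U j)" if "j \<in> ?J" for j using U(1)[OF that] finite_X finite_subset by blast
  have "card ?J * ((d + 2) choose 2) = (\<Sum>j\<in>?J. (d + 2) choose 2)" by simp
  also have "\<dots> \<le> (\<Sum>j\<in>?J. card (pairs (U j)))"
    using U(2) finU by (intro sum_mono) (simp only: card_pairs binomial_right_mono)
  also have "\<dots> = card (\<Union>j\<in>?J. pairs (U j))"
  proof (rule card_UN_disjoint[symmetric, OF finJ])
    show "\<forall>j\<in>?J. finite (pairs (U j))" using finU finite_pairs by blast
    show "\<forall>i\<in>?J. \<forall>j\<in>?J. i \<noteq> j \<longrightarrow> pairs (U i) \<inter> pairs (U j) = {}"
    proof (intro ballI impI)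
      fix i j assume ij: "i \<in> ?J" "j \<in> ?J" "i \<noteq> j"
      from stress_supports_disjoint[OF assms(1,2) this] U(3)[OF ij(1)] U(3)[OF ij(2)]
      show "pairs (U i) \<inter> pairs (U j) = {}" by blast
    qed
  qed
  also have "\<dots> \<le> card E" using U(3) finite_E by (intro card_mono) auto
  also have "\<dots> = card B + card ?J"
  proof -
    have "B \<subseteq> E" using assms(1) by (simp add: frame_def)
    then show ?thesis using finite_E by (simp add: card_Diff_subset finite_subset card_mono)
  qed
  finally have count: "card ?J * ((d + 2) choose 2) \<le> card B + card ?J" .
  have c: "(d + 2) choose 2 = ?c + (d + 1)" by (simp add: numeral_2_eq_2)
  have cc: "2 * ?c = d * (d + 1)" using choose_two[of "d + 1"] by simp
  have "card ?J * ((d + 2) choose 2) = card ?J * ?c + d * card ?J + card ?J"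
    unfolding c by (simp add: algebra_simps)
  moreover have "d * card X = d * card ?J + 2 * ?c"
    unfolding cc assms(2)[symmetric] by (simp add: algebra_simps)
  ultimately have "card ?J * ?c \<le> ?c"
    using count assms(5) by linarith
  moreover have "?c > 0" using assms(3) by simp
  ultimately have "card ?J \<le> 1" by (metis mult_le_cancel2 mult_1)
  moreover have "card ?J \<ge> 1" using assms(2,4) by simp
  ultimately have "card ?J = 1" by simp
  then obtain j where j: "j \<in> ?J" by (metis card_1_singletonE insertI1)
  have card: "card X = d + 2" using assms(2) \<open>card ?J = 1\<close> by simp
  have "U j = X"
    using U(1,2)[OF j] finite_X card by (intro card_seteq) auto
  then have "E = pairs X" using U(3)[OF j] E_pairs by auto
  then show ?thesis using card by simp
qed

end

section \<open>Minimally globally rigid graphs\<close>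

lemma rigidity_rank_basis:
  fixes d :: nat
  assumes "finite (edges H)"
  defines "p \<equiv> SOME p. generic d (verts H) p"
  obtains B where "B \<subseteq> edges H" "rows_independent d (verts H) p B" "card B = rigidity_rank d H"
    "\<And>B'. B' \<subseteq> edges H \<Longrightarrow> rows_independent d (verts H) p B' \<Longrightarrow> card B' \<le> card B"
proof -
  let ?S = "{card F |F. rigidity_indep d H F}"
  have "?S \<subseteq> {..card (edges H)}"
    using card_mono[OF assms(1)] by (auto simp: rigidity_indep_def)
  then have fin: "finite ?S" by (rule finite_subset) simp
  have "rigidity_indep d H {}" by (simp add: rigidity_indep_def rows_independent_def)
  then have "?S \<noteq> {}" by blast
  from Max_in[OF fin this] obtain B where B: "rigidity_indep d H B" "card B = rigidity_rank d H"
    by (auto simp: rigidity_rank_def)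
  have "card B' \<le> card B" if "rigidity_indep d H B'" for B'
    using Max_ge[OF fin, of "card B'"] that B(2) by (auto simp: rigidity_rank_def)
  then show ?thesis using that[of B] B unfolding rigidity_indep_def p_def by blast
qed

lemma generic_subset: "generic d V p \<Longrightarrow> X \<subseteq> V \<Longrightarrow> generic d X p"
  unfolding generic_def by blast

text \<open>If \<open>e\<close> were redundant, its length would be determined by the other edges of \<open>G[X]\<close> at all generic
  configurations, and global rigidity of \<open>G\<close> would pass to \<open>G - e\<close>.\<close>

lemma minimally_globally_rigid_irredundant:
  assumes "simple_graph G" "minimally_globally_rigid d G" "X \<subseteq> verts G"
    and "generic_point (X \<times> {..<d}) x" "e \<in> edges (induced G X)"
  shows "\<not> stress_redundant d X x (edges (induced G X)) e"
proof
  assume red: "stress_redundant d X x (edges (induced G X)) e"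
  have finV: "finite (verts G)" using assms(1) by (simp add: simple_graph_def)
  have E: "edges (induced G X) \<subseteq> pairs X"
    using assms(1) by (auto simp: induced_def pairs_def simple_graph_def)
  have "e \<in> edges G" using assms(5) by (simp add: induced_def)
  then have "\<not> globally_rigid d (del_edge G e)"
    using assms(2) by (simp add: minimally_globally_rigid_def)
  then obtain p q u v where p: "generic d (verts G) p"
    and same: "\<forall>a\<in>edges G - {e}. measurement d p a = measurement d q a"
    and uv: "u \<in> verts G" "v \<in> verts G" "sq_len d p u v \<noteq> sq_len d q u v"
    by (auto simp: globally_rigid_def del_edge_def)
  have finX: "finite X" using assms(3) finV finite_subset by blast
  have "generic_point (X \<times> {..<d}) (case_prod p)"
    using generic_imp_generic_point[OF generic_subset[OF p assms(3)] finX] .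
  from stress_redundant_imp_determined[OF finX assms(4) E red this, of "case_prod q"] same
  have "measurement d p e = measurement d q e"
    by (simp add: induced_def)
  then have "\<forall>a\<in>edges G. measurement d p a = measurement d q a" using same by blast
  then show False
    using assms(2) p uv unfolding minimally_globally_rigid_def globally_rigid_def by blast
qed

theorem theorem5p3:
  fixes d :: nat and G :: "'v graph" and X :: "'v set"
  assumes "d > 0"
    and "simple_graph G"
    and "minimally_globally_rigid d G"
    and "X \<subseteq> verts G"
    and "card X \<ge> d + 2"
  shows "int (card (edges (induced G X)))
           \<le> int (rigidity_rank d (induced G X)) + int (card X) - int d - 1
       \<and> int (rigidity_rank d (induced G X)) + int (card X) - int d - 1
           \<le> (int d + 1) * int (card X) - int ((d + 2) choose 2)
       \<and> (\<not> is_complete_graph (d + 2) (induced G X) \<longrightarrow>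
           int (card (edges (induced G X)))
             < int (rigidity_rank d (induced G X)) + int (card X) - int d - 1)"
proof -
  let ?H = "induced G X"
  define E where "E = edges ?H"
  define p where "p = (SOME p. generic d X p)"
  define x where "x = case_prod p"
  have curry_x: "curry x = p" by (simp add: x_def)
  have verts_H: "verts ?H = X" by (simp add: induced_def)
  have finX: "finite X"
    using assms(2,4) finite_subset by (auto simp: simple_graph_def)
  have E: "E \<subseteq> pairs X"
    using assms(2) by (auto simp: E_def induced_def pairs_def simple_graph_def)
  have finE: "finite E" using E finite_pairs[OF finX] finite_subset by blast
  obtain B where B: "B \<subseteq> E" "rows_independent d X p B" "card B = rigidity_rank d ?H"
    and max: "\<And>B'. B' \<subseteq> E \<Longrightarrow> rows_independent d X p B' \<Longrightarrow> card B' \<le> card B"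
    using rigidity_rank_basis[of ?H d] finE unfolding verts_H E_def p_def by metis
  have c: "(d + 2) choose 2 = ((d + 1) choose 2) + (d + 1)" by (simp add: numeral_2_eq_2)
  have main: "card (E - B) + d + 1 \<le> card X \<and> card B + ((d + 1) choose 2) \<le> d * card X \<and>
    (card (E - B) + d + 1 = card X \<longrightarrow> is_complete_graph (d + 2) ?H)"
  proof (cases "edges G = {}")
    case True
    then have "E = {}" by (simp add: E_def induced_def)
    have "2 * ((d + 1) choose 2) = d * (d + 1)" using choose_two[of "d + 1"] by simp
    also have "\<dots> \<le> d * card X" using assms(5) by (intro mult_left_mono) auto
    finally show ?thesis using B(1) \<open>E = {}\<close> assms(5) by simp
  next
    case False
    then obtain e where "e \<in> edges G" by blast
    then have "\<not> globally_rigid d (del_edge G e)"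
      using assms(3) by (simp add: minimally_globally_rigid_def)
    \<comment> \<open>Since the deletion of e destroys global rigidity, there is a generic configuration.\<close>
    then obtain p' where "generic d (verts G) p'"
      by (auto simp: globally_rigid_def del_edge_def)
    then have "generic d X p'" using assms(4) by (rule generic_subset)
    then have "generic d X p" unfolding p_def by (rule someI[of "generic d X"])
    from generic_imp_generic_point[OF this finX]
    have gen: "generic_point (X \<times> {..<d}) x" by (simp add: x_def)
    interpret irredundant_framework d X x E
    proof
      show "finite X" by (rule finX)
      show "generic_point (X \<times> {..<d}) x" by (rule gen)
      show "E \<subseteq> pairs X" by (rule E)
      show "d + 1 \<le> card X" using assms(5) by simp
      show "\<not> stress_redundant d X x E e" if "e \<in> E" for e
        using that unfolding E_def
        by (rule minimally_globally_rigid_irredundant[OF assms(2-4) gen])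
    qed
    have "\<exists>\<omega>. fundamental_stress d X x B e \<omega>" if "e \<in> E - B" for e
      by (rule fundamental_stress_exists[OF finX E B(1) _ _ that]) (simp_all add: curry_x B(2) max)
    then have "\<forall>e\<in>E - B. \<exists>\<omega>. fundamental_stress d X x B e \<omega>" by blast
    from bchoice[OF this] obtain \<omega> where "\<forall>e\<in>E - B. fundamental_stress d X x B e (\<omega> e)" ..
    then have frame: "frame B \<omega>" using B by (simp add: frame_def curry_x)
    have bound: "card B + ((d + 1) choose 2) \<le> d * card X"
      using independent_rows_bound[OF finX gen, of B] B E assms(5) by (simp add: curry_x)
    have "is_complete_graph (d + 2) ?H" if "card (E - B) + d + 1 = card X"
      using equality_imp_complete[OF frame that assms(1,5) bound]
      by (simp add: is_complete_graph_def verts_H E_def pairs_def)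
    then show ?thesis using nonbasis_bound[OF frame] bound by blast
  qed
  have "int (card B + ((d + 1) choose 2)) \<le> int (d * card X)"
    using main by (intro of_nat_mono) blast
  then have "int (card B) + int ((d + 1) choose 2) \<le> int d * int (card X)" by simp
  moreover have "card E = card B + card (E - B)"
    using B(1) finE by (metis card_Diff_subset card_mono finite_subset le_add_diff_inverse)
  ultimately show ?thesis
    using main unfolding c E_def[symmetric] B(3)[symmetric] by (auto simp: algebra_simps)
qed

end
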